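(* The following hold: (i) for any $f\in L^{1}(\mu)$, $\|f\|_{*}\le 2\|f\|_{1}$; (ii) for any $f\in L^{2}(\mu)$, $\|f\|_{*}\le\|f\|_{2}$; (iii) for any $f\in L^{\Phi}(\mu)$, $\|f\|_{*}\le\|f\|_{\Phi}$. Moreover, $\|\cdot\|_{*}$ and $\|\cdot\|_{\Phi}$ are different norms, and the bound in (iii) is optimal, i.e. there is no constant $c<1$ such that $\|f\|_{*}\le c\,\|f\|_{\Phi}$ for all $f\in L^{\Phi}(\mu)$.
   Context: $(X,\mathcal{A},\mu)$ is a non-atomic infinite Borel measure space, i.e. measurably isomorphic to the real line with its Borel sets and Lebesgue measure. Poisson space $(X^{*},\mathcal{A}^{*},\mu^{*})$: $X^{*}$ is the set of measures of the form $\sum_{i\in I}\delta_{x_i}$, $x_i\in X$, $I$ countable; $\mathcal{A}^{*}=\sigma\{N(A): A\in\mathcal{A}\}$ with $N(A)(\omega)=\omega(A)$; $\mu^{*}$ is the unique probability measure such that for pairwise disjoint $A_1,\dots,A_k\in\mathcal{A}$ of finite $\mu$-measure, $N(A_1),\dots,N(A_k)$ are independent and Poisson distributed with parameters $\mu(A_1),\dots,\mu(A_k)$. For $f\in L^1(\mu)$, $N(f)(\omega)=\int_X f\,d\omega$ and $\mu(f)=\int_X f\,d\mu$. Let $\Phi(x)=x^{2}$ for $0\le x\le1$ and $\Phi(x)=2x-1$ for $x>1$. $L^{\Phi}(\mu)=\{f\in L^{0}(\mu):\int_X\Phi(|f|)\,d\mu<\infty\}$; it contains $L^{1}(\mu)$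 and $L^{2}(\mu)$. Let $\Psi(y)=y^{2}$ for $0\le y\le2$ and $\Psi(y)=+\infty$ for $y>2$. The Orlicz norm is $$\|f\|_{\Phi}:=\sup\Big\{\int_X|fg|\,d\mu:\ g\in L^0(\mu),\ \int_X\Psi(|g|)\,d\mu\le1\Big\}.$$ For $f\in L^{\Phi}(\mu)$, $I_1(f):=\lim_{\epsilon\to0}\big(N(f1_{|f|>\epsilon})-\mu(f1_{|f|>\epsilon})\big)$, limit in $\mu^{*}$-measure; this is an integrable centered random variable, equal to $N(f)-\mu(f)$ if $f\in L^{1}(\mu)$. The Poisson-Orlicz norm is $\|f\|_{*}:=\|I_1(f)\|_{L^{1}(\mu^{*})}$. *)

theory Defs
  imports "HOL-Probability.Probability"
begin

definition isomorphic_to_real_line :: "'a measure \<Rightarrow> bool" where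
  "isomorphic_to_real_line M \<longleftrightarrow>
     (\<exists>T \<in> M \<rightarrow>\<^sub>M borel. \<exists>S \<in> borel \<rightarrow>\<^sub>M M.
        (\<forall>x\<in>space M. S (T x) = x) \<and> (\<forall>y::real. T (S y) = y) \<and> distr M borel T = lborel)"

(* Countable index sets are represented by arbitrary (finite or infinite, possibly empty) sets
   of natural numbers; points may repeat.  The integral over the counting measure is the sum over
   the index set, and "return M x" is the Dirac measure at x. *)
definition point_measures :: "'a measure \<Rightarrow> 'a measure set" where
  "point_measures M =
     {\<omega>. sets \<omega> = sets M \<and>
        (\<exists>(I :: nat set) x. x \<in> I \<rightarrow> space M \<and>
           (\<forall>A\<in>sets M. emeasure \<omega> A = (\<integral>\<^sup>+ i. emeasure (return M (x i)) A \<partial>count_space I)))}"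

(* Only the space and the sigma-algebra of this measure are of interest. *)
definition point_algebra :: "'a measure \<Rightarrow> 'a measure measure" where
  "point_algebra M =
     (SUP A\<in>sets M. vimage_algebra (point_measures M) (\<lambda>\<omega>. emeasure \<omega> A) borel)"

(* The Poisson law is spelled out by its weights, since poisson_pmf excludes the parameter 0. *)
definition is_poisson_measure :: "'a measure \<Rightarrow> 'a measure measure \<Rightarrow> bool" where
  "is_poisson_measure M P \<longleftrightarrow>
     prob_space P \<and> sets P = sets (point_algebra M) \<and>
     (\<forall>(k::nat) (A :: nat \<Rightarrow> 'a set).
        (\<forall>i<k. A i \<in> sets M \<and> emeasure M (A i) < \<infinity>) \<and> disjoint_family_on A {..<k} \<longrightarrow>
          prob_space.indep_vars P (\<lambda>_. borel) (\<lambda>i \<omega>. emeasure \<omega> (A i)) {..<k} \<and>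
          (\<forall>i<k. \<forall>n::nat.
             measure P {\<omega> \<in> space P. emeasure \<omega> (A i) = of_nat n} =
               measure M (A i) ^ n / fact n * exp (- measure M (A i))))"

definition L1_norm :: "'b measure \<Rightarrow> ('b \<Rightarrow> real) \<Rightarrow> ennreal" where
  "L1_norm M f = (\<integral>\<^sup>+ x. ennreal \<bar>f x\<bar> \<partial>M)"

definition L2_norm :: "'b measure \<Rightarrow> ('b \<Rightarrow> real) \<Rightarrow> real" where
  "L2_norm M f = sqrt (LINT x|M. (f x)\<^sup>2)"

(* Used at nonnegative arguments only. *)
definition Phi :: "real \<Rightarrow> real" where
  "Phi x = (if x \<le> 1 then x\<^sup>2 else 2 * x - 1)"

definition Psi :: "real \<Rightarrow> ennreal" where
  "Psi y = (if y \<le> 2 then ennreal (y\<^sup>2) else \<infinity>)"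

definition LPhi :: "'a measure \<Rightarrow> ('a \<Rightarrow> real) set" where
  "LPhi M = {f \<in> borel_measurable M. (\<integral>\<^sup>+ x. ennreal (Phi \<bar>f x\<bar>) \<partial>M) < \<infinity>}"

definition Orlicz_norm :: "'a measure \<Rightarrow> ('a \<Rightarrow> real) \<Rightarrow> ennreal" where
  "Orlicz_norm M f =
     (SUP g \<in> {g \<in> borel_measurable M. (\<integral>\<^sup>+ x. Psi \<bar>g x\<bar> \<partial>M) \<le> 1}.
        \<integral>\<^sup>+ x. ennreal \<bar>f x * g x\<bar> \<partial>M)"

definition tendsto_in_measure ::
  "'b measure \<Rightarrow> ('t \<Rightarrow> 'b \<Rightarrow> real) \<Rightarrow> ('b \<Rightarrow> real) \<Rightarrow> 't filter \<Rightarrow> bool" where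
  "tendsto_in_measure P X Z F \<longleftrightarrow>
     (\<forall>t. X t \<in> borel_measurable P) \<and> Z \<in> borel_measurable P \<and>
     (\<forall>\<delta>>0. ((\<lambda>t. emeasure P {\<omega> \<in> space P. \<bar>X t \<omega> - Z \<omega>\<bar> > \<delta>}) \<longlongrightarrow> 0) F)"

definition truncation :: "('a \<Rightarrow> real) \<Rightarrow> real \<Rightarrow> 'a \<Rightarrow> real" where
  "truncation f \<epsilon> x = (if \<bar>f x\<bar> > \<epsilon> then f x else 0)"

(* The limit in measure is unique up to P-null sets; one version of it is chosen. *)
definition I1 :: "'a measure \<Rightarrow> 'a measure measure \<Rightarrow> ('a \<Rightarrow> real) \<Rightarrow> 'a measure \<Rightarrow> real" where
  "I1 M P f =
     (SOME Z. tendsto_in_measure P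
        (\<lambda>\<epsilon> \<omega>. (LINT x|\<omega>. truncation f \<epsilon> x) - (LINT x|M. truncation f \<epsilon> x)) Z (at_right 0))"

definition Poisson_Orlicz_norm :: "'a measure \<Rightarrow> 'a measure measure \<Rightarrow> ('a \<Rightarrow> real) \<Rightarrow> ennreal" where
  "Poisson_Orlicz_norm M P f = L1_norm P (I1 M P f)"

(* Norms on a vector space of measurable functions, with functions equal almost everywhere
   identified. Invariance under almost everywhere equality follows from the definiteness and
   triangle clauses. *)
definition is_norm_on :: "'a measure \<Rightarrow> ('a \<Rightarrow> real) set \<Rightarrow> (('a \<Rightarrow> real) \<Rightarrow> ennreal) \<Rightarrow> bool" where
  "is_norm_on M V N \<longleftrightarrow>
     (\<lambda>x. 0) \<in> V \<and>
     (\<forall>f\<in>V. \<forall>g\<in>V. (\<lambda>x. f x + g x) \<in> V \<and> N (\<lambda>x. f x + g x) \<le> N f + N g) \<and>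
     (\<forall>f\<in>V. \<forall>c::real. (\<lambda>x. c * f x) \<in> V \<and> N (\<lambda>x. c * f x) = ennreal \<bar>c\<bar> * N f) \<and>
     (\<forall>f\<in>V. N f < \<infinity> \<and> (N f = 0 \<longleftrightarrow> (AE x in M. f x = 0)))"

end

theory Submission
  imports Defs
begin

text \<open>
  On integrable functions the compensated integral \<open>J f = N(f) - \<mu>(f)\<close> satisfies
  \<open>\<parallel>J f\<parallel>\<^sub>1 \<le> 2 \<parallel>f\<parallel>\<^sub>1\<close> by Campbell's formula, and \<open>\<parallel>J f\<parallel>\<^sub>1 \<le> \<parallel>f\<parallel>\<^sub>2\<close> because disjoint sets have
  uncorrelated counts.  For \<open>f\<close> in \<open>L\<^sup>\<Phi>\<close> the part of \<open>f\<close> below height \<open>\<epsilon>\<close> tends to \<open>0\<close> in \<open>L\<^sup>2\<close>, so the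
  compensated truncations are Cauchy in \<open>L\<^sup>1\<close>; hence \<open>I\<^sub>1\<close> exists, is linear, and inherits both bounds.

  The set over which the supremum in the Orlicz norm is taken is the intersection of the unit ball
  of \<open>L\<^sup>2\<close> with the ball of radius \<open>2\<close> of \<open>L\<^sup>\<infinity>\<close>.  Clamping \<open>f\<close> at the level \<open>t\<close> with
  \<open>\<integral> min(\<bar>f\<bar>/t, 1)\<^sup>2 = 1/4\<close> gives \<open>f = f\<^sub>1 + f\<^sub>2\<close> with \<open>\<parallel>f\<^sub>1\<parallel>\<^sub>2 + 2 \<parallel>f\<^sub>2\<parallel>\<^sub>1 = \<integral> \<bar>f g\<bar>\<close> for the competitor
  \<open>g = 2 min(\<bar>f\<bar>/t, 1)\<close>, which proves (iii).

  Definiteness follows by testing \<open>I\<^sub>1(f)\<close> against the void event \<open>N(A) = 0\<close>, which gives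
  \<open>- exp(-\<mu>(A)) \<integral>\<^sub>A f\<close>.  The indicator of a set of small measure \<open>l\<close> has norms \<open>2 l exp(-l)\<close> and
  \<open>2 l\<close>, so the norms differ and the constant \<open>1\<close> is optimal.
\<close>

subsection \<open>Measurability on the configuration space\<close>

lemma space_point_algebra: "space (point_algebra M) = point_measures M"
  unfolding point_algebra_def by (auto simp: space_Sup_eq_UN)

lemma measurable_emeasure_point_algebra:
  "A \<in> sets M \<Longrightarrow> (\<lambda>\<omega>. emeasure \<omega> A) \<in> borel_measurable (point_algebra M)"
  unfolding point_algebra_def by (rule measurable_SUP1) (auto intro: measurable_vimage_algebra1)

text \<open>Of the isomorphism with the line, the locale keeps sigma-finiteness. The isomorphism
  itself returns at the very end, to supply sets of prescribed small measure.\<close>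

locale poisson_space = sigma_finite_measure M + P: prob_space P
  for M :: "'a measure" and P :: "'a measure measure" +
  assumes poisson: "is_poisson_measure M P"
begin

lemma sets_P: "sets P = sets (point_algebra M)"
  using poisson by (simp add: is_poisson_measure_def)

lemma space_P: "space P = point_measures M"
  using sets_eq_imp_space_eq[OF sets_P] by (simp add: space_point_algebra)

lemma sets_config: "\<omega> \<in> space P \<Longrightarrow> sets \<omega> = sets M"
  by (simp add: space_P point_measures_def)

lemma space_config: "\<omega> \<in> space P \<Longrightarrow> space \<omega> = space M"
  by (rule sets_eq_imp_space_eq) (rule sets_config)

lemma measurable_config: "\<omega> \<in> space P \<Longrightarrow> measurable \<omega> N = measurable M N"
  by (rule measurable_cong_sets) (simp_all add: sets_config)

lemma measurable_emeasure_config [measurable]: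
  "A \<in> sets M \<Longrightarrow> (\<lambda>\<omega>. emeasure \<omega> A) \<in> borel_measurable P"
  using measurable_emeasure_point_algebra by (simp add: measurable_cong_sets[OF sets_P])

lemma measurable_measure_config [measurable]:
  "A \<in> sets M \<Longrightarrow> (\<lambda>\<omega>. measure \<omega> A) \<in> borel_measurable P"
  unfolding measure_def by measurable

text \<open>The sigma-algebra on configurations is generated by counts of sets, so measurability
  spreads from indicators to sums, multiples and monotone limits. All integral identities are used
  for configurations in \<open>space P\<close> only, where
  \<open>sets \<omega> = sets M\<close>.\<close>

lemma measurable_nn_integral_config [measurable]:
  fixes f :: "'a \<Rightarrow> ennreal"
  assumes "f \<in> borel_measurable M"
  shows "(\<lambda>\<omega>. \<integral>\<^sup>+x. f x \<partial>\<omega>) \<in> borel_measurable P"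
  using assms
proof (induction rule: borel_measurable_induct)
  case (cong f g)
  have "(\<integral>\<^sup>+x. f x \<partial>\<omega>) = (\<integral>\<^sup>+x. g x \<partial>\<omega>)" if "\<omega> \<in> space P" for \<omega>
    using cong(3) that by (intro nn_integral_cong) (simp add: space_config)
  with cong(4) show ?case
    by (subst (asm) measurable_cong) auto
next
  case (set A)
  have "(\<integral>\<^sup>+x. indicator A x \<partial>\<omega>) = emeasure \<omega> A" if "\<omega> \<in> space P" for \<omega>
    using set that by (intro nn_integral_indicator) (simp add: sets_config)
  with set show ?case
    by (subst measurable_cong) auto
next
  case (mult u c)
  have "(\<lambda>\<omega>. c * (\<integral>\<^sup>+x. u x \<partial>\<omega>)) \<in> borel_measurable P"
    using mult(4) by simp
  also have "?this \<longleftrightarrow> (\<lambda>\<omega>. \<integral>\<^sup>+x. c * u x \<partial>\<omega>) \<in> borel_measurable P"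
    using mult(2) by (intro measurable_cong nn_integral_cmult[symmetric]) (simp add: measurable_config)
  finally show ?case .
next
  case (add u v)
  have "(\<lambda>\<omega>. (\<integral>\<^sup>+x. v x \<partial>\<omega>) + (\<integral>\<^sup>+x. u x \<partial>\<omega>)) \<in> borel_measurable P"
    using add by simp
  also have "?this \<longleftrightarrow> (\<lambda>\<omega>. \<integral>\<^sup>+x. v x + u x \<partial>\<omega>) \<in> borel_measurable P"
    using add by (intro measurable_cong nn_integral_add[symmetric]) (simp_all add: measurable_config)
  finally show ?case .
next
  case (seq U)
  have "(\<lambda>\<omega>. SUP i. \<integral>\<^sup>+x. U i x \<partial>\<omega>) \<in> borel_measurable P"
    using seq.IH by (rule borel_measurable_SUP[rotated]) simp
  also have "?this \<longleftrightarrow> (\<lambda>\<omega>. \<integral>\<^sup>+x. (SUP i. U i) x \<partial>\<omega>) \<in> borel_measurable P"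
    unfolding SUP_apply using seq
    by (intro measurable_cong nn_integral_monotone_convergence_SUP[symmetric])
      (simp_all add: measurable_config)
  finally show ?case .
qed

lemma measurable_integral_config [measurable]:
  fixes f :: "'a \<Rightarrow> real"
  assumes [measurable]: "f \<in> borel_measurable M"
  shows "(\<lambda>\<omega>. LINT x|\<omega>. f x) \<in> borel_measurable P"
proof -
  \<comment> \<open>The Bochner integral takes the default value 0 on configurations for which
    \<open>f\<close> is not integrable; the case split makes this default explicit.\<close>
  have "(LINT x|\<omega>. f x) = (if (\<integral>\<^sup>+x. ennreal \<bar>f x\<bar> \<partial>\<omega>) < \<infinity>
      then enn2real (\<integral>\<^sup>+x. ennreal (f x) \<partial>\<omega>) - enn2real (\<integral>\<^sup>+x. ennreal (- f x) \<partial>\<omega>) else 0)"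
    if "\<omega> \<in> space P" for \<omega>
    using assms that
    by (auto simp: integrable_iff_bounded measurable_config real_lebesgue_integral_def
        not_integrable_integral_eq)
  moreover have "(\<lambda>\<omega>. if (\<integral>\<^sup>+x. ennreal \<bar>f x\<bar> \<partial>\<omega>) < \<infinity>
      then enn2real (\<integral>\<^sup>+x. ennreal (f x) \<partial>\<omega>) - enn2real (\<integral>\<^sup>+x. ennreal (- f x) \<partial>\<omega>) else 0)
    \<in> borel_measurable P"
    by measurable
  ultimately show ?thesis
    by (subst measurable_cong) auto
qed

end

subsection \<open>Poisson counts\<close>

lemma poisson_weights_sums:
  fixes l :: real
  shows "(\<lambda>n. l ^ n / fact n * exp (- l)) sums 1"
    and "(\<lambda>n. real n * (l ^ n / fact n * exp (- l))) sums l"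
    and "(\<lambda>n. (real n)\<^sup>2 * (l ^ n / fact n * exp (- l))) sums (l + l\<^sup>2)"
proof -
  have e: "exp l * exp (- l) = 1"
    by (simp add: exp_minus)
  have 0: "(\<lambda>n. l ^ n / fact n) sums exp l"
    using exp_converges[of l] by (simp add: divide_inverse_commute scaleR_conv_of_real)
  \<comment> \<open>A factor \<open>n\<close> cancels against the factorial and shifts the index.
    The mean uses this once; the second moment uses it once more and leaves a sum of the two earlier
    series.\<close>
  have shift: "real (Suc n) * (l ^ Suc n / fact (Suc n)) = l * (l ^ n / fact n)" for n
    by (simp add: field_simps del: of_nat_Suc)
  have 1: "(\<lambda>n. real n * (l ^ n / fact n)) sums (l * exp l)"
    using sums_mult[OF 0, of l] unfolding shift[symmetric]
    by (subst (asm) sums_Suc_iff) simp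
  have 2: "(\<lambda>n. (real n)\<^sup>2 * (l ^ n / fact n)) sums (l * (l * exp l + exp l))"
  proof -
    have "real (Suc n) * (real (Suc n) * (l ^ Suc n / fact (Suc n)))
        = l * (real n * (l ^ n / fact n) + l ^ n / fact n)" for n
      unfolding shift by (simp add: algebra_simps add_divide_distrib)
    then have "(real (Suc n))\<^sup>2 * (l ^ Suc n / fact (Suc n))
        = l * (real n * (l ^ n / fact n) + l ^ n / fact n)" for n
      by (simp only: power2_eq_square mult.assoc)
    then have "(\<lambda>n. (real (Suc n))\<^sup>2 * (l ^ Suc n / fact (Suc n))) sums (l * (l * exp l + exp l))"
      using sums_mult[OF sums_add[OF 1 0], of l] by simp
    then show ?thesis
      by (subst (asm) sums_Suc_iff) simp
  qed
  show "(\<lambda>n. l ^ n / fact n * exp (- l)) sums 1"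
    using sums_mult2[OF 0, of "exp (- l)"] by (simp add: e)
  show "(\<lambda>n. real n * (l ^ n / fact n * exp (- l))) sums l"
    using sums_mult2[OF 1, of "exp (- l)"] by (simp add: e mult.assoc)
  have "l * (l * exp l + exp l) * exp (- l) = l + l\<^sup>2"
    using e by (simp add: algebra_simps power2_eq_square)
  then show "(\<lambda>n. (real n)\<^sup>2 * (l ^ n / fact n * exp (- l))) sums (l + l\<^sup>2)"
    using sums_mult2[OF 2, of "exp (- l)"] by (simp add: mult.assoc)
qed

context poisson_space
begin

lemma poisson_finite_family:
  fixes A :: "nat \<Rightarrow> 'a set"
  assumes "\<And>i. i < k \<Longrightarrow> A i \<in> sets M" "\<And>i. i < k \<Longrightarrow> emeasure M (A i) < \<infinity>"
    and "disjoint_family_on A {..<k}"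
  shows "P.indep_vars (\<lambda>_. borel) (\<lambda>i \<omega>. emeasure \<omega> (A i)) {..<k}"
    and "i < k \<Longrightarrow> measure P {\<omega> \<in> space P. emeasure \<omega> (A i) = of_nat n}
      = measure M (A i) ^ n / fact n * exp (- measure M (A i))"
proof -
  have "P.indep_vars (\<lambda>_. borel) (\<lambda>i \<omega>. emeasure \<omega> (A i)) {..<k} \<and>
      (\<forall>i<k. \<forall>n::nat. measure P {\<omega> \<in> space P. emeasure \<omega> (A i) = of_nat n} =
         measure M (A i) ^ n / fact n * exp (- measure M (A i)))"
    by (rule poisson[unfolded is_poisson_measure_def, THEN conjunct2, THEN conjunct2, rule_format])
      (use assms in auto)
  then show "P.indep_vars (\<lambda>_. borel) (\<lambda>i \<omega>. emeasure \<omega> (A i)) {..<k}"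
    and "i < k \<Longrightarrow> measure P {\<omega> \<in> space P. emeasure \<omega> (A i) = of_nat n}
      = measure M (A i) ^ n / fact n * exp (- measure M (A i))"
    by simp_all
qed

lemma prob_count:
  assumes "A \<in> sets M" "emeasure M A < \<infinity>"
  shows "measure P {\<omega> \<in> space P. emeasure \<omega> A = of_nat n}
    = measure M A ^ n / fact n * exp (- measure M A)"
  using poisson_finite_family(2)[of 1 "\<lambda>_. A" 0] assms by (simp add: disjoint_family_on_def)

lemma indep_counts:
  assumes "A \<in> sets M" "emeasure M A < \<infinity>" "B \<in> sets M" "emeasure M B < \<infinity>" "A \<inter> B = {}"
  shows "P.indep_var borel (\<lambda>\<omega>. emeasure \<omega> A) borel (\<lambda>\<omega>. emeasure \<omega> B)"
proof -
  define C where "C i = (if i = 0 then A else B)" for i :: nat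
  have "P.indep_vars (\<lambda>_. borel) (\<lambda>i \<omega>. emeasure \<omega> (C i)) {..<2}"
    by (rule poisson_finite_family(1)) (use assms in \<open>auto simp: C_def disjoint_family_on_def\<close>)
  \<comment> \<open>The two-element family is split into the blocks {0} and {1}, and evaluation at
    the single coordinate of each block turns this into independence of two variables.\<close>
  then have "P.indep_var (PiM {0} (\<lambda>_. borel)) (\<lambda>\<omega>. restrict (\<lambda>i. emeasure \<omega> (C i)) {0})
      (PiM {1} (\<lambda>_. borel)) (\<lambda>\<omega>. restrict (\<lambda>i. emeasure \<omega> (C i)) {1})"
    by (rule P.indep_var_restrict) auto
  then have "P.indep_var borel ((\<lambda>x. x 0) \<circ> (\<lambda>\<omega>. restrict (\<lambda>i. emeasure \<omega> (C i)) {0}))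
      borel ((\<lambda>x. x 1) \<circ> (\<lambda>\<omega>. restrict (\<lambda>i. emeasure \<omega> (C i)) {1}))"
    by (rule P.indep_var_compose) auto
  then show ?thesis
    by (simp add: comp_def C_def)
qed

text \<open>The law is prescribed through the probabilities of the finite values \<open>n\<close>.
  These sum to 1, so no mass is left for an infinite count.\<close>

lemma AE_count_nat:
  assumes [measurable]: "A \<in> sets M" and "emeasure M A < \<infinity>"
  shows "AE \<omega> in P. \<exists>n. emeasure \<omega> A = of_nat n"
proof -
  define E where "E n = {\<omega> \<in> space P. emeasure \<omega> A = of_nat n}" for n :: nat
  have [measurable]: "E n \<in> sets P" for n
    unfolding E_def by measurable
  have "(\<lambda>n. measure P (E n)) sums measure P (\<Union>n. E n)"
    by (rule P.finite_measure_UNION) (auto simp: disjoint_family_on_def E_def)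
  moreover have "measure P (E n) = measure M A ^ n / fact n * exp (- measure M A)" for n
    unfolding E_def by (rule prob_count[OF assms])
  ultimately have "measure P (\<Union>n. E n) = 1"
    by (intro sums_unique2[OF _ poisson_weights_sums(1)]) simp
  then have "AE \<omega> in P. \<omega> \<in> (\<Union>n. E n)"
    by (subst P.AE_in_set_eq_1) auto
  then show ?thesis
    by eventually_elim (auto simp: E_def)
qed

text \<open>Expectation of a function of a Poisson count as a series over its weights.
  \<open>g\<close> records \<open>G\<close> on the naturals; what \<open>G\<close> does elsewhere,
  for instance at infinity, is seen on a null event only. This allows \<open>G\<close> to pass
  through \<open>enn2real\<close>.\<close>

lemma nn_integral_count:
  assumes A[measurable]: "A \<in> sets M" "emeasure M A < \<infinity>"
    and G[measurable]: "G \<in> borel_measurable borel"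
    and g: "\<And>n. G (of_nat n) = ennreal (g n)" "\<And>n. 0 \<le> g n"
    and s: "(\<lambda>n. g n * (measure M A ^ n / fact n * exp (- measure M A))) sums s"
  shows "(\<integral>\<^sup>+\<omega>. G (emeasure \<omega> A) \<partial>P) = ennreal s"
proof -
  define E where "E n = {\<omega> \<in> space P. emeasure \<omega> A = of_nat n}" for n :: nat
  have [measurable]: "E n \<in> sets P" for n
    unfolding E_def by measurable
  have dj: "disjoint_family E"
    by (auto simp: disjoint_family_on_def E_def)
  have "(\<integral>\<^sup>+\<omega>. G (emeasure \<omega> A) \<partial>P) = (\<integral>\<^sup>+\<omega>. (\<Sum>n. ennreal (g n) * indicator (E n) \<omega>) \<partial>P)"
  proof (intro nn_integral_cong_AE)
    show "AE \<omega> in P. G (emeasure \<omega> A) = (\<Sum>n. ennreal (g n) * indicator (E n) \<omega>)"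
      using AE_count_nat[OF A] AE_space
    proof eventually_elim
      case (elim \<omega>)
      then obtain n where "emeasure \<omega> A = of_nat n" "\<omega> \<in> E n"
        by (auto simp: E_def)
      then show ?case
        using suminf_cmult_indicator[OF dj, of \<omega> n "\<lambda>n. ennreal (g n)"] by (simp add: g)
    qed
  qed
  also have "\<dots> = (\<Sum>n. ennreal (g n) * emeasure P (E n))"
    by (subst nn_integral_suminf) (auto simp: nn_integral_cmult_indicator)
  also have "\<dots> = (\<Sum>n. ennreal (g n * (measure M A ^ n / fact n * exp (- measure M A))))"
    by (intro suminf_cong, subst ennreal_mult)
      (simp_all add: P.emeasure_eq_measure E_def prob_count[OF A] g)
  also have "\<dots> = ennreal s"
    using s by (intro suminf_ennreal_eq) (auto simp: g)
  finally show ?thesis .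
qed

lemma nn_integral_emeasure_config:
  assumes "A \<in> sets M" "emeasure M A < \<infinity>"
  shows "(\<integral>\<^sup>+\<omega>. emeasure \<omega> A \<partial>P) = emeasure M A"
proof -
  have "(\<integral>\<^sup>+\<omega>. emeasure \<omega> A \<partial>P) = ennreal (measure M A)"
    using nn_integral_count[OF assms, where g = real and G = "\<lambda>y. y",
        OF _ _ _ poisson_weights_sums(2)]
    by (simp add: ennreal_of_nat_eq_real_of_nat)
  then show ?thesis
    using assms by (simp add: emeasure_eq_ennreal_measure less_top)
qed

lemma count_mean:
  assumes [measurable]: "A \<in> sets M" and "emeasure M A < \<infinity>"
  shows "has_bochner_integral P (\<lambda>\<omega>. measure \<omega> A) (measure M A)"
proof (rule has_bochner_integral_nn_integral)
  show "(\<integral>\<^sup>+\<omega>. ennreal (measure \<omega> A) \<partial>P) = ennreal (measure M A)"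
    using nn_integral_count[OF assms, where g = real and G = "\<lambda>y. ennreal (enn2real y)",
        OF _ _ _ poisson_weights_sums(2)]
    by (simp add: measure_def)
qed simp_all

lemma count_second_moment:
  assumes [measurable]: "A \<in> sets M" and "emeasure M A < \<infinity>"
  shows "has_bochner_integral P (\<lambda>\<omega>. (measure \<omega> A)\<^sup>2) (measure M A + (measure M A)\<^sup>2)"
proof (rule has_bochner_integral_nn_integral)
  show "(\<integral>\<^sup>+\<omega>. ennreal ((measure \<omega> A)\<^sup>2) \<partial>P) = ennreal (measure M A + (measure M A)\<^sup>2)"
    using nn_integral_count[OF assms, where g = "\<lambda>n. (real n)\<^sup>2"
        and G = "\<lambda>y. ennreal ((enn2real y)\<^sup>2)", OF _ _ _ poisson_weights_sums(3)]
    by (simp add: measure_def)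
qed simp_all

text \<open>Obtained by expanding the square into the first two moments. The product form makes this
  the diagonal term, and the covariance below the off-diagonal term, of one double sum.\<close>

lemma centred_count_variance:
  assumes A: "A \<in> sets M" "emeasure M A < \<infinity>"
  shows "has_bochner_integral P (\<lambda>\<omega>. (measure \<omega> A - measure M A) * (measure \<omega> A - measure M A))
    (measure M A)"
proof -
  let ?m = "measure M A"
  have const: "has_bochner_integral P (\<lambda>_. ?m\<^sup>2) (?m\<^sup>2)"
    by (simp add: has_bochner_integral_iff P.prob_space)
  have "has_bochner_integral P (\<lambda>\<omega>. (measure \<omega> A)\<^sup>2 - 2 * ?m * measure \<omega> A + ?m\<^sup>2)
      (?m + ?m\<^sup>2 - 2 * ?m * ?m + ?m\<^sup>2)"
    by (rule has_bochner_integral_add[OF has_bochner_integral_diff[OF count_second_moment[OF A]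
            has_bochner_integral_mult_right[OF count_mean[OF A]]] const])
  moreover have "(measure \<omega> A)\<^sup>2 - 2 * ?m * measure \<omega> A + ?m\<^sup>2
      = (measure \<omega> A - ?m) * (measure \<omega> A - ?m)" for \<omega>
    by (simp add: power2_eq_square algebra_simps)
  moreover have "?m + ?m\<^sup>2 - 2 * ?m * ?m + ?m\<^sup>2 = ?m"
    by (simp add: power2_eq_square)
  ultimately show ?thesis
    by (simp only:)
qed

lemma centred_counts_covariance:
  assumes A[measurable]: "A \<in> sets M" "emeasure M A < \<infinity>"
    and B[measurable]: "B \<in> sets M" "emeasure M B < \<infinity>"
    and "A \<inter> B = {}"
  shows "has_bochner_integral P (\<lambda>\<omega>. (measure \<omega> A - measure M A) * (measure \<omega> B - measure M B)) 0"
proof -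
  have "P.indep_var borel ((\<lambda>y. enn2real y - measure M A) \<circ> (\<lambda>\<omega>. emeasure \<omega> A))
     borel ((\<lambda>y. enn2real y - measure M B) \<circ> (\<lambda>\<omega>. emeasure \<omega> B))"
    by (rule P.indep_var_compose[OF indep_counts]) (use assms in auto)
  then have i: "P.indep_var borel (\<lambda>\<omega>. measure \<omega> A - measure M A)
      borel (\<lambda>\<omega>. measure \<omega> B - measure M B)"
    by (simp add: comp_def measure_def)
  have C: "integrable P (\<lambda>\<omega>. measure \<omega> C - measure M C)"
      "(LINT \<omega>|P. measure \<omega> C - measure M C) = 0"
    if "C \<in> sets M" "emeasure M C < \<infinity>" for C
    using count_mean[OF that] by (simp_all add: has_bochner_integral_iff P.prob_space)
  show ?thesis
    unfolding has_bochner_integral_iff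
    using P.indep_var_lebesgue_integral[OF i C(1)[OF A] C(1)[OF B]]
      P.indep_var_integrable[OF i C(1)[OF A] C(1)[OF B]] C(2)[OF A] by simp
qed

end

subsection \<open>Campbell formulas\<close>

context poisson_space begin
text \<open>One induction serves two formulas: weight 1 with \<open>D\<close> the whole space, and
  the indicator of a void event with \<open>D\<close> the complement of the avoided set. The base
  case is asked for on sets of finite measure, because the Poisson law speaks about those
  only.\<close>

lemma weighted_campbell:
  fixes f :: "'a \<Rightarrow> ennreal" and w :: "'a measure \<Rightarrow> ennreal"
  assumes [measurable]: "w \<in> borel_measurable P" "D \<in> sets M" "f \<in> borel_measurable M"
    and base: "\<And>B. B \<in> sets M \<Longrightarrow> emeasure M B < \<infinity>
      \<Longrightarrow> (\<integral>\<^sup>+\<omega>. w \<omega> * emeasure \<omega> B \<partial>P) = c * emeasure M (B \<inter> D)"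
  shows "(\<integral>\<^sup>+\<omega>. w \<omega> * (\<integral>\<^sup>+x. f x \<partial>\<omega>) \<partial>P) = c * (\<integral>\<^sup>+x. f x * indicator D x \<partial>M)"
  using assms(3)
proof (induction rule: borel_measurable_induct)
  case (cong f g)
  have "(\<integral>\<^sup>+x. f x * indicator D x \<partial>M) = (\<integral>\<^sup>+x. g x * indicator D x \<partial>M)"
    using cong.hyps(3) by (intro nn_integral_cong) simp
  moreover have "(\<integral>\<^sup>+\<omega>. w \<omega> * (\<integral>\<^sup>+x. f x \<partial>\<omega>) \<partial>P) = (\<integral>\<^sup>+\<omega>. w \<omega> * (\<integral>\<^sup>+x. g x \<partial>\<omega>) \<partial>P)"
    using cong.hyps(3) by (intro nn_integral_cong arg_cong2[where f="(*)"]) (simp_all add: space_config)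
  ultimately show ?case
    using cong.IH by simp
next
  case (set B)
  note [measurable] = set
  \<comment> \<open>A set of infinite measure is exhausted by sets of finite measure, to which
    \<open>base\<close> applies.\<close>
  obtain F :: "nat \<Rightarrow> 'a set" where F: "range F \<subseteq> sets M" "(\<Union>i. F i) = space M"
    "\<And>i. emeasure M (F i) \<noteq> \<infinity>" "incseq F"
    using sigma_finite_incseq by blast
  then have [measurable]: "F i \<in> sets M" for i
    by auto
  define C where "C i = B \<inter> F i" for i
  have C[measurable]: "C i \<in> sets M" for i
    unfolding C_def by measurable
  have incC: "incseq C"
    using F(4) by (auto simp: C_def incseq_def)
  have UC: "(\<Union>i. C i) = B"
    using F(2) sets.sets_into_space[OF set] by (auto simp: C_def)
  have fin: "emeasure M (C i) < \<infinity>" for i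
  proof -
    have "emeasure M (C i) \<le> emeasure M (F i)"
      by (intro emeasure_mono) (auto simp: C_def)
    then show ?thesis
      using F(3)[of i] by (simp add: less_top order.strict_trans1)
  qed
  \<comment> \<open>\<open>incseq\<close> asks for monotonicity at every \<omega>, but counts are
    known to be monotone in the set only when \<open>sets \<omega> = sets M\<close>. The indicator
    of \<open>space P\<close> forces the other values to 0 without changing the integral.\<close>
  have inc': "incseq (\<lambda>i \<omega>. w \<omega> * emeasure \<omega> (C i) * indicator (space P) \<omega>)"
    using incC by (auto simp: incseq_def le_fun_def sets_config split: split_indicator
        intro!: mult_left_mono emeasure_mono)
  have "(\<integral>\<^sup>+\<omega>. w \<omega> * (\<integral>\<^sup>+x. indicator B x \<partial>\<omega>) \<partial>P)
      = (\<integral>\<^sup>+\<omega>. (SUP i. w \<omega> * emeasure \<omega> (C i) * indicator (space P) \<omega>) \<partial>P)"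
  proof (intro nn_integral_cong)
    fix \<omega> assume \<omega>: "\<omega> \<in> space P"
    have "(SUP i. emeasure \<omega> (C i)) = emeasure \<omega> B"
      using incC C \<omega> by (subst SUP_emeasure_incseq) (auto simp: sets_config UC)
    then show "w \<omega> * (\<integral>\<^sup>+x. indicator B x \<partial>\<omega>)
        = (SUP i. w \<omega> * emeasure \<omega> (C i) * indicator (space P) \<omega>)"
      using \<omega> set by (simp add: SUP_mult_left_ennreal[symmetric] sets_config)
  qed
  also have "\<dots> = (SUP i. \<integral>\<^sup>+\<omega>. w \<omega> * emeasure \<omega> (C i) * indicator (space P) \<omega> \<partial>P)"
    by (rule nn_integral_monotone_convergence_SUP[OF inc']) measurable
  also have "\<dots> = (SUP i. c * emeasure M (C i \<inter> D))"
    using base[OF C fin] by (simp cong: nn_integral_cong)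
  also have "\<dots> = c * emeasure M (\<Union>i. C i \<inter> D)"
    using incC by (subst SUP_mult_left_ennreal[symmetric], subst SUP_emeasure_incseq)
      (auto simp: incseq_def)
  also have "(\<Union>i. C i \<inter> D) = B \<inter> D"
    using UC by auto
  finally show ?case
    by (simp add: indicator_inter_arith[symmetric])
next
  case (mult u k)
  note [measurable] = mult.hyps(2)
  have "(\<integral>\<^sup>+\<omega>. w \<omega> * (\<integral>\<^sup>+x. k * u x \<partial>\<omega>) \<partial>P) = (\<integral>\<^sup>+\<omega>. k * (w \<omega> * (\<integral>\<^sup>+x. u x \<partial>\<omega>)) \<partial>P)"
    using mult.hyps(2) by (intro nn_integral_cong)
      (simp add: nn_integral_cmult measurable_config mult_ac)
  also have "\<dots> = k * (c * (\<integral>\<^sup>+x. u x * indicator D x \<partial>M))"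
    using mult.IH by (simp add: nn_integral_cmult)
  also have "\<dots> = c * (\<integral>\<^sup>+x. k * u x * indicator D x \<partial>M)"
    by (simp add: nn_integral_cmult mult_ac)
  finally show ?case .
next
  case (add u v)
  note [measurable] = add.hyps(1,3)
  have "(\<integral>\<^sup>+\<omega>. w \<omega> * (\<integral>\<^sup>+x. v x + u x \<partial>\<omega>) \<partial>P)
      = (\<integral>\<^sup>+\<omega>. w \<omega> * (\<integral>\<^sup>+x. v x \<partial>\<omega>) + w \<omega> * (\<integral>\<^sup>+x. u x \<partial>\<omega>) \<partial>P)"
    using add.hyps(1,3)
    by (intro nn_integral_cong) (simp add: nn_integral_add measurable_config distrib_left)
  also have "\<dots> = c * (\<integral>\<^sup>+x. v x * indicator D x \<partial>M) + c * (\<integral>\<^sup>+x. u x * indicator D x \<partial>M)"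
    using add.IH by (simp add: nn_integral_add)
  also have "\<dots> = c * (\<integral>\<^sup>+x. (v x + u x) * indicator D x \<partial>M)"
    by (simp add: nn_integral_add distrib_right distrib_left)
  finally show ?case .
next
  case (seq U)
  note [measurable] = seq.hyps(1)
  have incU: "incseq (\<lambda>i x. U i x * indicator D x)"
    using seq.hyps(3) by (auto simp: incseq_def le_fun_def intro!: mult_right_mono)
  have inc': "incseq (\<lambda>i \<omega>. w \<omega> * (\<integral>\<^sup>+x. U i x \<partial>\<omega>))"
    using seq.hyps(3) by (auto simp: incseq_def le_fun_def intro!: mult_left_mono nn_integral_mono)
  have "(\<integral>\<^sup>+\<omega>. w \<omega> * (\<integral>\<^sup>+x. (SUP i. U i) x \<partial>\<omega>) \<partial>P)
      = (\<integral>\<^sup>+\<omega>. (SUP i. w \<omega> * (\<integral>\<^sup>+x. U i x \<partial>\<omega>)) \<partial>P)"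
    unfolding SUP_apply using seq.hyps(1,3)
    by (intro nn_integral_cong)
      (simp add: nn_integral_monotone_convergence_SUP measurable_config SUP_mult_left_ennreal)
  also have "\<dots> = (SUP i. \<integral>\<^sup>+\<omega>. w \<omega> * (\<integral>\<^sup>+x. U i x \<partial>\<omega>) \<partial>P)"
    by (rule nn_integral_monotone_convergence_SUP[OF inc']) measurable
  also have "\<dots> = (SUP i. c * (\<integral>\<^sup>+x. U i x * indicator D x \<partial>M))"
    using seq.IH by simp
  also have "\<dots> = c * (\<integral>\<^sup>+x. (SUP i. U i x * indicator D x) \<partial>M)"
    by (simp add: SUP_mult_left_ennreal nn_integral_monotone_convergence_SUP[OF incU])
  also have "\<dots> = c * (\<integral>\<^sup>+x. (SUP i. U i) x * indicator D x \<partial>M)"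
    by (simp add: SUP_mult_right_ennreal image_comp)
  finally show ?case .
qed

lemma campbell:
  fixes f :: "'a \<Rightarrow> ennreal"
  assumes [measurable]: "f \<in> borel_measurable M"
  shows "(\<integral>\<^sup>+\<omega>. (\<integral>\<^sup>+x. f x \<partial>\<omega>) \<partial>P) = (\<integral>\<^sup>+x. f x \<partial>M)"
proof -
  have "(\<integral>\<^sup>+\<omega>. 1 * (\<integral>\<^sup>+x. f x \<partial>\<omega>) \<partial>P) = 1 * (\<integral>\<^sup>+x. f x * indicator (space M) x \<partial>M)"
    by (rule weighted_campbell)
      (auto simp: nn_integral_emeasure_config sets.Int_space_eq2)
  then show ?thesis
    by (simp cong: nn_integral_cong)
qed

text \<open>On the event that \<open>A\<close> is void, the points of \<open>B\<close> all lie in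
  \<open>B - A\<close>, and their number is independent of that event. The factor
  \<open>exp (- measure M A)\<close> is the probability of the event.\<close>

lemma void_campbell:
  fixes f :: "'a \<Rightarrow> ennreal"
  assumes A[measurable]: "A \<in> sets M" "emeasure M A < \<infinity>" and [measurable]: "f \<in> borel_measurable M"
  shows "(\<integral>\<^sup>+\<omega>. indicator {0} (emeasure \<omega> A) * (\<integral>\<^sup>+x. f x \<partial>\<omega>) \<partial>P)
    = ennreal (exp (- measure M A)) * (\<integral>\<^sup>+x. f x * indicator (space M - A) x \<partial>M)"
proof (rule weighted_campbell)
  fix B assume B[measurable]: "B \<in> sets M" "emeasure M B < \<infinity>"
  let ?C = "B \<inter> (space M - A)"
  have C: "?C \<in> sets M" "emeasure M ?C < \<infinity>"
    using B emeasure_mono[of ?C B M] by (auto intro: order.strict_trans1)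
  have "P.indep_var borel (indicator {0} \<circ> (\<lambda>\<omega>. emeasure \<omega> A)) borel ((\<lambda>y. y) \<circ> (\<lambda>\<omega>. emeasure \<omega> ?C))"
    by (rule P.indep_var_compose[OF indep_counts]) (use A C in auto)
  \<comment> \<open>Recast as a family indexed by booleans, to which the product formula for
    nonnegative variables applies.\<close>
  then have "P.indep_vars (\<lambda>_. borel)
      (case_bool (\<lambda>\<omega>. indicator {0} (emeasure \<omega> A) :: ennreal) (\<lambda>\<omega>. emeasure \<omega> ?C)) UNIV"
    by (simp add: P.indep_var_def comp_def bool.case_distrib[symmetric] case_bool_if)
  from P.indep_vars_nn_integral[OF _ this]
  have prod: "(\<integral>\<^sup>+\<omega>. indicator {0} (emeasure \<omega> A) * emeasure \<omega> ?C \<partial>P)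
    = (\<integral>\<^sup>+\<omega>. indicator {0} (emeasure \<omega> A) \<partial>P) * emeasure M ?C"
    by (simp add: UNIV_bool nn_integral_emeasure_config[OF C] mult.commute)
  have "(\<integral>\<^sup>+\<omega>. indicator {0} (emeasure \<omega> A) \<partial>P)
      = (\<integral>\<^sup>+\<omega>. indicator {\<omega> \<in> space P. emeasure \<omega> A = of_nat 0} \<omega> \<partial>P)"
    by (intro nn_integral_cong) (auto split: split_indicator)
  also have "\<dots> = ennreal (exp (- measure M A))"
    by (subst nn_integral_indicator) (auto simp: P.emeasure_eq_measure prob_count[OF A, of 0, simplified])
  finally have void: "(\<integral>\<^sup>+\<omega>. indicator {0} (emeasure \<omega> A) \<partial>P) = ennreal (exp (- measure M A))" .
  have "indicator {0} (emeasure \<omega> A) * emeasure \<omega> B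
      = (indicator {0} (emeasure \<omega> A) * emeasure \<omega> ?C :: ennreal)" if \<omega>: "\<omega> \<in> space P" for \<omega>
  proof (cases "emeasure \<omega> A = 0")
    case True
    have "emeasure \<omega> (B - A) = emeasure \<omega> B"
      using True \<omega> A B by (intro emeasure_Diff_null_set) (auto simp: null_sets_def sets_config)
    moreover have "?C = B - A"
      using sets.sets_into_space[OF B(1)] by auto
    ultimately show ?thesis by simp
  qed simp
  then show "(\<integral>\<^sup>+\<omega>. indicator {0} (emeasure \<omega> A) * emeasure \<omega> B \<partial>P)
      = ennreal (exp (- measure M A)) * emeasure M ?C"
    using prod void by (simp cong: nn_integral_cong)
qed measurable

end

subsection \<open>The compensated integral\<close>

lemma L1_norm_cong_AE: "AE x in M. f x = g x \<Longrightarrow> L1_norm M f = L1_norm M g"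
  unfolding L1_norm_def by (intro nn_integral_cong_AE) auto

lemma L1_norm_add_le:
  assumes "f \<in> borel_measurable M" "g \<in> borel_measurable M"
  shows "L1_norm M (\<lambda>x. f x + g x) \<le> L1_norm M f + L1_norm M g"
  unfolding L1_norm_def using assms
  by (subst nn_integral_add[symmetric])
    (auto intro!: nn_integral_mono simp: abs_triangle_ineq simp flip: ennreal_plus)

lemma L1_norm_cmult:
  "f \<in> borel_measurable M \<Longrightarrow> L1_norm M (\<lambda>x. c * f x) = ennreal \<bar>c\<bar> * L1_norm M f"
  unfolding L1_norm_def by (simp add: abs_mult ennreal_mult nn_integral_cmult)

lemma L1_norm_minus_commute: "L1_norm M (\<lambda>x. f x - g x) = L1_norm M (\<lambda>x. g x - f x)"
  unfolding L1_norm_def by (simp add: abs_minus_commute)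

lemma L1_norm_le_diff:
  assumes "f \<in> borel_measurable M" "g \<in> borel_measurable M"
  shows "L1_norm M f \<le> L1_norm M g + L1_norm M (\<lambda>x. g x - f x)"
  using L1_norm_add_le[of g M "\<lambda>x. f x - g x"] assms
  by (simp add: L1_norm_minus_commute[of M f g])

lemma L1_norm_eq_0_iff:
  "f \<in> borel_measurable M \<Longrightarrow> L1_norm M f = 0 \<longleftrightarrow> (AE x in M. f x = 0)"
  unfolding L1_norm_def by (subst nn_integral_0_iff_AE) auto

lemma L1_norm_eq_integral:
  "integrable M f \<Longrightarrow> L1_norm M f = ennreal (LINT x|M. \<bar>f x\<bar>)"
  unfolding L1_norm_def by (rule nn_integral_eq_integral) auto

lemma integrable_iff_L1_norm:
  "integrable M f \<longleftrightarrow> f \<in> borel_measurable M \<and> L1_norm M f < \<infinity>"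
  unfolding L1_norm_def integrable_iff_bounded by simp

text \<open>Cauchy-Schwarz against the constant 1, read off from the nonnegativity of the variance
  of the absolute value.\<close>

lemma (in prob_space) L1_norm_le_L2_norm:
  assumes [measurable]: "X \<in> borel_measurable M" and "integrable M (\<lambda>x. (X x)\<^sup>2)"
  shows "L1_norm M X \<le> ennreal (L2_norm M X)"
proof -
  have X: "integrable M X"
    using assms by (rule square_integrable_imp_integrable)
  have "0 \<le> variance (\<lambda>x. \<bar>X x\<bar>)"
    by (rule variance_positive)
  then have "(expectation (\<lambda>x. \<bar>X x\<bar>))\<^sup>2 \<le> expectation (\<lambda>x. (X x)\<^sup>2)"
    using X assms by (subst (asm) variance_eq) auto
  then have "expectation (\<lambda>x. \<bar>X x\<bar>) \<le> L2_norm M X"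
    unfolding L2_norm_def by (rule real_le_rsqrt)
  then show ?thesis
    using X by (simp add: L1_norm_eq_integral ennreal_leI)
qed

context poisson_space
begin

text \<open>If \<open>f\<close> is not integrable for \<omega>, the first integral is 0 by
  convention. For integrable \<open>f\<close> under \<open>M\<close> such configurations form a null
  event, so additivity of \<open>J\<close> in \<open>f\<close> is an almost sure statement.\<close>

definition J :: "('a \<Rightarrow> real) \<Rightarrow> 'a measure \<Rightarrow> real" where
  "J f \<omega> = (LINT x|\<omega>. f x) - (LINT x|M. f x)"

lemma measurable_J [measurable]: "f \<in> borel_measurable M \<Longrightarrow> J f \<in> borel_measurable P"
  by (subst J_def [abs_def]) (intro borel_measurable_diff measurable_integral_config borel_measurable_const)

text \<open>By Campbell's formula the random integral of the absolute value has finite mean, so it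
  is finite almost surely.\<close>

lemma AE_integrable_config:
  fixes f :: "'a \<Rightarrow> real"
  assumes "integrable M f"
  shows "AE \<omega> in P. integrable \<omega> f"
proof -
  have [measurable]: "f \<in> borel_measurable M"
    using assms by auto
  have "(\<integral>\<^sup>+\<omega>. (\<integral>\<^sup>+x. ennreal \<bar>f x\<bar> \<partial>\<omega>) \<partial>P) \<noteq> \<infinity>"
    using assms by (subst campbell) (auto simp: integrable_iff_bounded)
  then have "AE \<omega> in P. (\<integral>\<^sup>+x. ennreal \<bar>f x\<bar> \<partial>\<omega>) \<noteq> \<infinity>"
    by (intro nn_integral_noteq_infinite) auto
  then show ?thesis
    using AE_space
    by eventually_elim (simp add: integrable_iff_bounded measurable_config less_top)
qed

lemma J_add:
  assumes "integrable M f" "integrable M g"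
  shows "AE \<omega> in P. J (\<lambda>x. f x + g x) \<omega> = J f \<omega> + J g \<omega>"
  using AE_integrable_config[OF assms(1)] AE_integrable_config[OF assms(2)]
  by eventually_elim (simp add: J_def assms)

lemma J_cmult: "J (\<lambda>x. c * f x) \<omega> = c * J f \<omega>"
  by (simp add: J_def algebra_simps)

lemma J_diff:
  assumes "integrable M f" "integrable M g"
  shows "AE \<omega> in P. J (\<lambda>x. f x - g x) \<omega> = J f \<omega> - J g \<omega>"
  using AE_integrable_config[OF assms(1)] AE_integrable_config[OF assms(2)]
  by eventually_elim (simp add: J_def assms)

lemma L1_norm_J:
  assumes "integrable M f"
  shows "L1_norm P (J f) \<le> 2 * L1_norm M f"
proof -
  have [measurable]: "f \<in> borel_measurable M"
    using assms by auto
  have "ennreal \<bar>J f \<omega>\<bar> \<le> (\<integral>\<^sup>+x. ennreal \<bar>f x\<bar> \<partial>\<omega>) + L1_norm M f" for \<omega>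
  proof -
    \<comment> \<open>The bound also holds when \<open>f\<close> is not integrable, as the left side
      is then 0. Hence the estimate of \<open>J f\<close> holds for every configuration.\<close>
    have b: "ennreal \<bar>LINT x|N. f x\<bar> \<le> (\<integral>\<^sup>+x. ennreal \<bar>f x\<bar> \<partial>N)" for N
      using integral_norm_bound_ennreal[of N f]
      by (cases "integrable N f") (simp_all add: not_integrable_integral_eq)
    have "ennreal \<bar>J f \<omega>\<bar> \<le> ennreal (\<bar>LINT x|\<omega>. f x\<bar> + \<bar>LINT x|M. f x\<bar>)"
      by (intro ennreal_leI) (simp add: J_def)
    also have "\<dots> \<le> (\<integral>\<^sup>+x. ennreal \<bar>f x\<bar> \<partial>\<omega>) + L1_norm M f"
      using add_mono[OF b b] by (simp add: L1_norm_def)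
    finally show ?thesis .
  qed
  then have "L1_norm P (J f) \<le> (\<integral>\<^sup>+\<omega>. (\<integral>\<^sup>+x. ennreal \<bar>f x\<bar> \<partial>\<omega>) + L1_norm M f \<partial>P)"
    unfolding L1_norm_def[of P] by (intro nn_integral_mono)
  also have "\<dots> = 2 * L1_norm M f"
    by (simp add: nn_integral_add campbell P.emeasure_space_1 L1_norm_def mult_2)
  finally show ?thesis .
qed

lemma integrable_J:
  assumes "integrable M f"
  shows "integrable P (J f)"
proof -
  have "L1_norm P (J f) < \<infinity>"
    using L1_norm_J[OF assms] assms
    by (auto simp: integrable_iff_L1_norm[of M] ennreal_mult_less_top intro: order.strict_trans1)
  then show ?thesis
    using assms by (auto simp: integrable_iff_L1_norm)
qed

lemma void_mean_nonneg:
  fixes f :: "'a \<Rightarrow> real"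
  assumes A[measurable]: "A \<in> sets M" "emeasure M A < \<infinity>"
    and f: "integrable M f" "\<And>x. 0 \<le> f x"
  shows "has_bochner_integral P (\<lambda>\<omega>. indicator {0} (emeasure \<omega> A) * (LINT x|\<omega>. f x))
    (exp (- measure M A) * (LINT x|M. f x * indicator (space M - A) x))"
proof (rule has_bochner_integral_nn_integral)
  have [measurable]: "f \<in> borel_measurable M"
    using f by auto
  show "(\<lambda>\<omega>. indicator {0} (emeasure \<omega> A) * (LINT x|\<omega>. f x)) \<in> borel_measurable P"
    by measurable
  show "AE \<omega> in P. 0 \<le> indicator {0} (emeasure \<omega> A) * (LINT x|\<omega>. f x)"
    using f by (simp add: integral_nonneg_AE)
  show "0 \<le> exp (- measure M A) * (LINT x|M. f x * indicator (space M - A) x)"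
    using f by (simp add: integral_nonneg_AE)
  have "(\<integral>\<^sup>+\<omega>. ennreal (indicator {0} (emeasure \<omega> A) * (LINT x|\<omega>. f x)) \<partial>P)
      = (\<integral>\<^sup>+\<omega>. indicator {0} (emeasure \<omega> A) * (\<integral>\<^sup>+x. ennreal (f x) \<partial>\<omega>) \<partial>P)"
  proof (rule nn_integral_cong_AE)
    show "AE \<omega> in P. ennreal (indicator {0} (emeasure \<omega> A) * (LINT x|\<omega>. f x))
        = indicator {0} (emeasure \<omega> A) * (\<integral>\<^sup>+x. ennreal (f x) \<partial>\<omega>)"
      using AE_integrable_config[OF f(1)]
      by eventually_elim (simp add: nn_integral_eq_integral f(2) split: split_indicator)
  qed
  also have "\<dots> = ennreal (exp (- measure M A)) * (\<integral>\<^sup>+x. ennreal (f x * indicator (space M - A) x) \<partial>M)"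
    by (subst void_campbell[OF A])
      (auto intro!: arg_cong2[where f = "(*)"] nn_integral_cong split: split_indicator)
  also have "(\<integral>\<^sup>+x. ennreal (f x * indicator (space M - A) x) \<partial>M)
      = ennreal (LINT x|M. f x * indicator (space M - A) x)"
    by (intro nn_integral_eq_integral integrable_real_mult_indicator) (auto simp: f)
  finally show "(\<integral>\<^sup>+\<omega>. ennreal (indicator {0} (emeasure \<omega> A) * (LINT x|\<omega>. f x)) \<partial>P)
      = ennreal (exp (- measure M A) * (LINT x|M. f x * indicator (space M - A) x))"
    using f by (simp add: ennreal_mult integral_nonneg_AE)
qed

lemma prob_void:
  assumes [measurable]: "A \<in> sets M" and "emeasure M A < \<infinity>"
  shows "has_bochner_integral P (\<lambda>\<omega>. indicator {0} (emeasure \<omega> A) :: real) (exp (- measure M A))"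
proof -
  have "has_bochner_integral P (indicator {\<omega> \<in> space P. emeasure \<omega> A = of_nat 0} :: _ \<Rightarrow> real)
      (measure P {\<omega> \<in> space P. emeasure \<omega> A = of_nat 0})"
    by (intro has_bochner_integral_real_indicator) (auto simp: less_top[symmetric])
  also have "?this \<longleftrightarrow> ?thesis"
    unfolding prob_count[OF assms]
    by (intro has_bochner_integral_cong) (auto split: split_indicator)
  finally show ?thesis .
qed

text \<open>Conditioning on a void \<open>A\<close> deletes the part of \<open>f\<close> on
  \<open>A\<close> from the random integral but not from the compensator, and minus the integral
  over \<open>A\<close> remains. Correlations with void events thus recover \<open>f\<close> from
  \<open>J f\<close>; this is what definiteness of the norm rests on.\<close>

lemma void_mean_J:
  assumes A[measurable]: "A \<in> sets M" "emeasure M A < \<infinity>" and f: "integrable M f"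
  shows "(LINT \<omega>|P. indicator {0} (emeasure \<omega> A) * J f \<omega>)
    = - exp (- measure M A) * (LINT x|M. f x * indicator A x)"
proof -
  let ?p = "\<lambda>x. max 0 (f x)" and ?n = "\<lambda>x. max 0 (- f x)" and ?B = "space M - A"
  let ?w = "\<lambda>\<omega>. indicator {0} (emeasure \<omega> A) :: real" and ?e = "exp (- measure M A)"
  have [measurable]: "f \<in> borel_measurable M"
    using f by auto
  have pn: "integrable M ?p" "integrable M ?n"
    using f by auto
  have B: "integrable M (\<lambda>x. g x * indicator S x)" if "integrable M g" "S \<in> sets M"
    for g :: "'a \<Rightarrow> real" and S
    using that by (rule integrable_real_mult_indicator[rotated])
  have hp: "has_bochner_integral P (\<lambda>\<omega>. ?w \<omega> * (LINT x|\<omega>. ?p x))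
      (?e * (LINT x|M. ?p x * indicator ?B x))"
    and hn: "has_bochner_integral P (\<lambda>\<omega>. ?w \<omega> * (LINT x|\<omega>. ?n x))
      (?e * (LINT x|M. ?n x * indicator ?B x))"
    using void_mean_nonneg[OF A] pn by auto
  have hc: "has_bochner_integral P (\<lambda>\<omega>. ?w \<omega> * (LINT x|M. f x)) (?e * (LINT x|M. f x))"
    by (intro has_bochner_integral_mult_left prob_void A)
  note h = has_bochner_integral_diff[OF has_bochner_integral_diff[OF hp hn] hc]
  have "(LINT \<omega>|P. ?w \<omega> * J f \<omega>) = (LINT \<omega>|P. ?w \<omega> * (LINT x|\<omega>. ?p x)
      - ?w \<omega> * (LINT x|\<omega>. ?n x) - ?w \<omega> * (LINT x|M. f x))"
  proof (intro integral_cong_AE)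
    show "AE \<omega> in P. ?w \<omega> * J f \<omega> = ?w \<omega> * (LINT x|\<omega>. ?p x)
      - ?w \<omega> * (LINT x|\<omega>. ?n x) - ?w \<omega> * (LINT x|M. f x)"
      using AE_integrable_config[OF pn(1)] AE_integrable_config[OF pn(2)]
    proof eventually_elim
      case (elim \<omega>)
      have "(LINT x|\<omega>. f x) = (LINT x|\<omega>. ?p x - ?n x)"
        by (intro Bochner_Integration.integral_cong) auto
      also have "\<dots> = (LINT x|\<omega>. ?p x) - (LINT x|\<omega>. ?n x)"
        using elim by simp
      finally show ?case
        by (simp only: J_def right_diff_distrib)
    qed
  qed measurable
  also have "\<dots> = ?e * ((LINT x|M. ?p x * indicator ?B x) - (LINT x|M. ?n x * indicator ?B x)
      - (LINT x|M. f x))"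
    using has_bochner_integral_integral_eq[OF h] by (simp add: algebra_simps)
  also have "(LINT x|M. ?p x * indicator ?B x) - (LINT x|M. ?n x * indicator ?B x) - (LINT x|M. f x)
      = (LINT x|M. ?p x * indicator ?B x - ?n x * indicator ?B x - f x)"
    using B[OF pn(1), of ?B] B[OF pn(2), of ?B] f by simp
  also have "\<dots> = (LINT x|M. - (f x * indicator A x))"
    by (intro Bochner_Integration.integral_cong) (auto split: split_indicator)
  finally show ?thesis
    by simp
qed

text \<open>\<open>J f\<close> is a linear combination of centred counts of disjoint level sets.
  These counts are orthogonal with variance equal to the measure of the set, so the second moment of
  \<open>J f\<close> is the integral of the square of \<open>f\<close>.\<close>

lemma L1_norm_J_simple:
  assumes f: "simple_function M f" "integrable M f"
  shows "L1_norm P (J f) \<le> ennreal (L2_norm M f)"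
proof -
  \<comment> \<open>The value 0 is left out because its level set may have infinite measure.\<close>
  define Y where "Y = f ` space M - {0}"
  define A where "A y = f -` {y} \<inter> space M" for y
  have [simp]: "finite Y"
    using f by (simp add: Y_def simple_function_def)
  have [measurable]: "f \<in> borel_measurable M"
    using f by auto
  have A[measurable]: "A y \<in> sets M" for y
    unfolding A_def by measurable
  have fin: "emeasure M (A y) < \<infinity>" if "y \<in> Y" for y
  proof -
    have "integrable M (\<lambda>x. f x * indicator (A y) x)"
      using f by (intro integrable_real_mult_indicator) auto
    also have "?this \<longleftrightarrow> integrable M (\<lambda>x. y * indicator (A y) x)"
      by (intro Bochner_Integration.integrable_cong) (auto simp: A_def split: split_indicator)
    finally show ?thesis
      using that by (auto simp: Y_def integrable_indicator_iff)
  qed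
  have dj: "A y \<inter> A z = {}" if "y \<noteq> z" for y z
    using that by (auto simp: A_def)
  have rep: "h (f x) = (\<Sum>y\<in>Y. h y * indicator (A y) x)" if "x \<in> space M" "h 0 = 0"
    for x and h :: "real \<Rightarrow> real"
  proof -
    have "(\<Sum>y\<in>Y. h y * indicator (A y) x) = (\<Sum>y\<in>Y. if y = f x then h (f x) else 0)"
      using that by (intro sum.cong) (auto simp: A_def)
    also have "\<dots> = (if f x \<in> Y then h (f x) else 0)"
      by simp
    also have "\<dots> = h (f x)"
      using that by (auto simp: Y_def)
    finally show ?thesis by simp
  qed
  \<comment> \<open>With \<open>h\<close> the identity, the instances for \<omega> and for
    \<open>M\<close> compute \<open>J f\<close>; with \<open>h\<close> the square, the instance for
    \<open>M\<close> computes the L2 norm. The condition \<open>h 0 = 0\<close> compensates for the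
    omitted level set.\<close>
  have int_rep: "(LINT x|N. h (f x)) = (\<Sum>y\<in>Y. h y * measure N (A y))"
    if N: "sets N = sets M" "\<And>y. y \<in> Y \<Longrightarrow> emeasure N (A y) < \<infinity>" and h: "h 0 = 0"
    for N and h :: "real \<Rightarrow> real"
  proof -
    have sp: "space N = space M"
      using N by (rule_tac sets_eq_imp_space_eq)
    have AN: "A y \<inter> space N = A y" for y
      by (auto simp: A_def sp)
    have "(LINT x|N. h (f x)) = (LINT x|N. (\<Sum>y\<in>Y. h y * indicator (A y) x))"
      using rep[of _ h] h by (intro Bochner_Integration.integral_cong) (auto simp: sp)
    also have "\<dots> = (\<Sum>y\<in>Y. h y * measure N (A y))"
      using N by (subst Bochner_Integration.integral_sum)
        (auto simp: AN N intro!: integrable_mult_right)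
    finally show ?thesis .
  qed
  define S where "S \<omega> = (\<Sum>y\<in>Y. y * (measure \<omega> (A y) - measure M (A y)))" for \<omega>
  have [measurable]: "S \<in> borel_measurable P"
    unfolding S_def by measurable
  have "AE \<omega> in P. \<forall>y\<in>Y. emeasure \<omega> (A y) < \<infinity>"
  proof (rule AE_finite_allI)
    fix y assume "y \<in> Y"
    from AE_count_nat[OF A fin[OF this]] show "AE \<omega> in P. emeasure \<omega> (A y) < \<infinity>"
      by eventually_elim (auto simp: of_nat_less_top)
  qed simp
  then have JS: "AE \<omega> in P. J f \<omega> = S \<omega>"
    using AE_space
  proof eventually_elim
    case (elim \<omega>)
    then show ?case
      using int_rep[of \<omega> "\<lambda>y. y"] int_rep[of M "\<lambda>y. y"] fin
      by (simp add: J_def S_def sets_config sum_subtractf algebra_simps)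
  qed
  \<comment> \<open>The square of \<open>S\<close> is expanded into a double sum in which only the
    diagonal has nonzero expectation.\<close>
  have "has_bochner_integral P (\<lambda>\<omega>. \<Sum>y\<in>Y. \<Sum>z\<in>Y. (y * z) *
      ((measure \<omega> (A y) - measure M (A y)) * (measure \<omega> (A z) - measure M (A z))))
    (\<Sum>y\<in>Y. \<Sum>z\<in>Y. (y * z) * (if y = z then measure M (A y) else 0))"
  proof (intro has_bochner_integral_sum has_bochner_integral_mult_right)
    fix y z assume "y \<in> Y" "z \<in> Y"
    then show "has_bochner_integral P
        (\<lambda>\<omega>. (measure \<omega> (A y) - measure M (A y)) * (measure \<omega> (A z) - measure M (A z)))
        (if y = z then measure M (A y) else 0)"
      using centred_count_variance[OF A fin] centred_counts_covariance[OF A fin A fin dj] by auto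
  qed
  also have "(\<lambda>\<omega>. \<Sum>y\<in>Y. \<Sum>z\<in>Y. (y * z) *
      ((measure \<omega> (A y) - measure M (A y)) * (measure \<omega> (A z) - measure M (A z)))) = (\<lambda>\<omega>. (S \<omega>)\<^sup>2)"
    by (simp add: fun_eq_iff S_def power2_eq_square sum_product mult_ac)
  also have "(\<Sum>y\<in>Y. \<Sum>z\<in>Y. (y * z) * (if y = z then measure M (A y) else 0))
      = (\<Sum>y\<in>Y. y\<^sup>2 * measure M (A y))"
    by (simp add: if_distrib[of "\<lambda>t. _ * t"] sum.delta power2_eq_square cong: if_cong)
  also have "\<dots> = (LINT x|M. (f x)\<^sup>2)"
    using int_rep[of M "\<lambda>y. y\<^sup>2"] fin by simp
  finally have S2: "has_bochner_integral P (\<lambda>\<omega>. (S \<omega>)\<^sup>2) (LINT x|M. (f x)\<^sup>2)" .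
  have "L1_norm P (J f) = L1_norm P S"
    using JS by (rule L1_norm_cong_AE)
  also have "\<dots> \<le> ennreal (L2_norm P S)"
    using S2 by (intro P.L1_norm_le_L2_norm) (auto simp: has_bochner_integral_iff)
  also have "L2_norm P S = L2_norm M f"
    using S2 by (simp add: L2_norm_def has_bochner_integral_iff)
  finally show ?thesis .
qed

text \<open>Simple functions dominated by a multiple of \<open>f\<close> approximate it in L1, which
  controls \<open>J\<close> through the first bound, while their L2 norms converge. The inequality
  for simple functions then passes to the limit.\<close>

lemma L1_norm_J_L2:
  assumes f: "integrable M f" "integrable M (\<lambda>x. (f x)\<^sup>2)"
  shows "L1_norm P (J f) \<le> ennreal (L2_norm M f)"
proof -
  have [measurable]: "f \<in> borel_measurable M"
    using f by auto
  \<comment> \<open>The factor 2 comes from the metric approximation theorem with reference point 0.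
    It is harmless, since it enters the dominating functions only.\<close>
  have "\<exists>F. (\<forall>i. simple_function M (F i)) \<and> (\<forall>x\<in>space M. (\<lambda>i. F i x) \<longlonglongrightarrow> f x) \<and>
      (\<forall>i. \<forall>x\<in>space M. \<bar>F i x\<bar> \<le> 2 * \<bar>f x\<bar>)"
    using borel_measurable_implies_sequence_metric[of f M 0] by (simp add: dist_real_def)
  then obtain F where F: "\<And>i. simple_function M (F i)" "\<And>x. x \<in> space M \<Longrightarrow> (\<lambda>i. F i x) \<longlonglongrightarrow> f x"
    "\<And>i x. x \<in> space M \<Longrightarrow> \<bar>F i x\<bar> \<le> 2 * \<bar>f x\<bar>"
    by blast
  have [measurable]: "F i \<in> borel_measurable M" for i
    using F(1) by (rule borel_measurable_simple_function)
  have Fi: "integrable M (F i)" for i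
    by (rule Bochner_Integration.integrable_bound[of M "\<lambda>x. 2 * f x"]) (use f F(3) in \<open>auto simp: abs_mult\<close>)
  have "(\<lambda>i. L1_norm M (\<lambda>x. f x - F i x)) \<longlonglongrightarrow> 0"
    unfolding L1_norm_def real_norm_def[symmetric]
  proof (rule nn_integral_dominated_convergence_norm[where w = "\<lambda>x. 2 * \<bar>f x\<bar>"])
    show "(\<integral>\<^sup>+x. ennreal (2 * \<bar>f x\<bar>) \<partial>M) < \<infinity>"
      using f(1) by (auto simp: integrable_iff_bounded ennreal_mult nn_integral_cmult
          ennreal_mult_less_top)
  qed (use F in auto)
  moreover have "(\<lambda>i. L2_norm M (F i)) \<longlonglongrightarrow> L2_norm M f"
    unfolding L2_norm_def
  proof (intro tendsto_real_sqrt integral_dominated_convergence[where w = "\<lambda>x. 4 * (f x)\<^sup>2"])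
    show "AE x in M. norm ((F i x)\<^sup>2) \<le> 4 * (f x)\<^sup>2" for i
    proof (rule AE_I2)
      fix x assume "x \<in> space M"
      from power_mono[OF F(3)[OF this, of i] abs_ge_zero, of 2]
      show "norm ((F i x)\<^sup>2) \<le> 4 * (f x)\<^sup>2"
        by (simp add: power_mult_distrib)
    qed
  qed (use f F in \<open>auto intro!: tendsto_power\<close>)
  ultimately have lim: "(\<lambda>i. ennreal (L2_norm M (F i)) + 2 * L1_norm M (\<lambda>x. f x - F i x))
      \<longlonglongrightarrow> ennreal (L2_norm M f) + 2 * 0"
    by (intro tendsto_add tendsto_ennrealI ennreal_tendsto_cmult) auto
  have "L1_norm P (J f) \<le> ennreal (L2_norm M (F i)) + 2 * L1_norm M (\<lambda>x. f x - F i x)" for i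
  proof -
    have "L1_norm P (J f) \<le> L1_norm P (J (F i)) + L1_norm P (\<lambda>\<omega>. J (F i) \<omega> - J f \<omega>)"
      by (rule L1_norm_le_diff) auto
    also have "L1_norm P (\<lambda>\<omega>. J (F i) \<omega> - J f \<omega>) = L1_norm P (J (\<lambda>x. f x - F i x))"
      unfolding L1_norm_minus_commute[of P "J (F i)"]
      by (intro L1_norm_cong_AE, use J_diff[OF f(1) Fi[of i]] in eventually_elim) simp
    also have "\<dots> \<le> 2 * L1_norm M (\<lambda>x. f x - F i x)"
      using f Fi by (intro L1_norm_J) auto
    also have "L1_norm P (J (F i)) \<le> ennreal (L2_norm M (F i))"
      by (intro L1_norm_J_simple F Fi)
    finally show ?thesis
      by (simp add: add_right_mono)
  qed
  then show ?thesis
    using LIMSEQ_le_const[OF lim] by simp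
qed

end

subsection \<open>The space LPhi and truncations\<close>

definition tail :: "('a \<Rightarrow> real) \<Rightarrow> real \<Rightarrow> 'a \<Rightarrow> real" where
  "tail f \<epsilon> x = (if \<bar>f x\<bar> > \<epsilon> then 0 else f x)"

lemma tail_eq: "tail f \<epsilon> x = f x - truncation f \<epsilon> x"
  by (simp add: tail_def truncation_def)

lemma abs_truncation_le: "\<bar>truncation f \<epsilon> x\<bar> \<le> \<bar>f x\<bar>"
  by (simp add: truncation_def)

lemma measurable_truncation [measurable]:
  assumes [measurable]: "f \<in> borel_measurable M"
  shows "truncation f \<epsilon> \<in> borel_measurable M"
  by (subst truncation_def [abs_def]) measurable

lemma measurable_tail [measurable]:
  assumes [measurable]: "f \<in> borel_measurable M"
  shows "tail f \<epsilon> \<in> borel_measurable M"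
  by (subst tail_def [abs_def]) measurable

section \<open>Comparison of \<open>Phi\<close> with linear and quadratic growth\<close>

lemma measurable_Phi [measurable]: "Phi \<in> borel_measurable borel"
  by (subst Phi_def [abs_def]) measurable

lemma Phi_nonneg: "0 \<le> x \<Longrightarrow> 0 \<le> Phi x"
  by (simp add: Phi_def)

lemma Phi_ge_1: "1 \<le> x \<Longrightarrow> 1 \<le> Phi x"
  by (simp add: Phi_def)

lemma Phi_le_square: "Phi x \<le> x\<^sup>2"
  using zero_le_power2[of "x - 1"] by (simp add: Phi_def power2_eq_square algebra_simps)

lemma Phi_le_linear: "0 \<le> x \<Longrightarrow> Phi x \<le> 2 * x"
  using mult_left_mono[of x 1 x] by (auto simp: Phi_def power2_eq_square)

text \<open>The larger of the two terms absorbs the other: the linear bound on \<open>Phi\<close>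
  applies if \<open>a\<close> dominates, the quadratic bound if \<open>b\<close> does.\<close>

lemma Phi_add_le:
  fixes a b :: real
  shows "Phi \<bar>a + b\<bar> \<le> 4 * \<bar>a\<bar> + 4 * b\<^sup>2"
proof (cases "\<bar>b\<bar> \<le> \<bar>a\<bar>")
  case True
  have "Phi \<bar>a + b\<bar> \<le> 2 * \<bar>a + b\<bar>"
    by (rule Phi_le_linear) simp
  also have "\<dots> \<le> 4 * \<bar>a\<bar>"
    using True abs_triangle_ineq[of a b] by simp
  also have "\<dots> \<le> 4 * \<bar>a\<bar> + 4 * b\<^sup>2"
    by simp
  finally show ?thesis .
next
  case False
  have "Phi \<bar>a + b\<bar> \<le> \<bar>a + b\<bar>\<^sup>2"
    by (rule Phi_le_square)
  also have "\<dots> \<le> (2 * \<bar>b\<bar>)\<^sup>2"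
    using False by (intro power_mono) auto
  finally show ?thesis
    by (simp add: power_mult_distrib)
qed

text \<open>This and \<open>le_Phi\<close> show that below any positive height a function of
  \<open>LPhi\<close> is square integrable and above it integrable. The summand 1 in the constant
  pays for \<open>x \<le> 1\<close>, the other for large \<open>x\<close>, where \<open>Phi\<close>
  is at least 1.\<close>

lemma min_le_Phi:
  assumes "0 \<le> x" "0 < t"
  shows "(min x t)\<^sup>2 \<le> (1 + t\<^sup>2) * Phi x"
proof (cases "x \<le> 1")
  case True
  have "(min x t)\<^sup>2 \<le> x\<^sup>2"
    using assms by (intro power_mono) auto
  then show ?thesis
    using True mult_right_mono[of 1 "1 + t\<^sup>2" "x\<^sup>2"] by (simp add: Phi_def)
next
  case False
  have "(min x t)\<^sup>2 \<le> t\<^sup>2"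
    using assms by (intro power_mono) auto
  also have "\<dots> \<le> (1 + t\<^sup>2) * 1"
    by simp
  also have "\<dots> \<le> (1 + t\<^sup>2) * Phi x"
    using False by (intro mult_left_mono Phi_ge_1) auto
  finally show ?thesis .
qed

lemma le_Phi:
  assumes "0 < t" "t < x"
  shows "x \<le> (1 + 1 / t) * Phi x"
proof (cases "x \<le> 1")
  case True
  have "x * t \<le> x * x"
    using assms by (intro mult_left_mono) auto
  then have "x \<le> (1 / t) * (x * x)"
    using assms by (simp add: field_simps)
  then show ?thesis
    using True by (simp add: Phi_def power2_eq_square distrib_right add_increasing)
next
  case False
  then have "x \<le> 1 * Phi x"
    by (simp add: Phi_def)
  also have "\<dots> \<le> (1 + 1 / t) * Phi x"
    using assms by (intro mult_right_mono Phi_nonneg) auto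
  finally show ?thesis .
qed

section \<open>\<open>LPhi\<close> as the sum of L1 and L2\<close>

lemma LPhi_iff:
  "f \<in> LPhi M \<longleftrightarrow> f \<in> borel_measurable M \<and> integrable M (\<lambda>x. Phi \<bar>f x\<bar>)"
  unfolding LPhi_def by (auto simp: integrable_iff_bounded Phi_nonneg)

lemma LPhi_measurable [measurable_dest]: "f \<in> LPhi M \<Longrightarrow> f \<in> borel_measurable M"
  by (simp add: LPhi_iff)

text \<open>Cutting a function at height 1 gives the reverse decomposition. Closure of
  \<open>LPhi\<close> under sums and multiples is then inherited from L1 and L2.\<close>

lemma LPhi_add:
  assumes "integrable M a" "b \<in> borel_measurable M" "integrable M (\<lambda>x. (b x)\<^sup>2)"
  shows "(\<lambda>x. a x + b x) \<in> LPhi M"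
proof -
  have [measurable]: "a \<in> borel_measurable M" "b \<in> borel_measurable M"
    using assms by auto
  have "integrable M (\<lambda>x. Phi \<bar>a x + b x\<bar>)"
  proof (rule Bochner_Integration.integrable_bound)
    show "integrable M (\<lambda>x. 4 * \<bar>a x\<bar> + 4 * (b x)\<^sup>2)"
      using assms by auto
    show "AE x in M. norm (Phi \<bar>a x + b x\<bar>) \<le> norm (4 * \<bar>a x\<bar> + 4 * (b x)\<^sup>2)"
      using Phi_add_le by (auto simp: Phi_nonneg)
  qed measurable
  then show ?thesis
    by (simp add: LPhi_iff)
qed

lemma integrable_imp_LPhi: "integrable M f \<Longrightarrow> f \<in> LPhi M"
  using LPhi_add[of M f "\<lambda>x. 0"] by simp

lemma square_integrable_imp_LPhi:
  "f \<in> borel_measurable M \<Longrightarrow> integrable M (\<lambda>x. (f x)\<^sup>2) \<Longrightarrow> f \<in> LPhi M"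
  using LPhi_add[of M "\<lambda>x. 0" f] by simp

lemma integrable_truncation:
  assumes "f \<in> LPhi M" "0 < \<epsilon>"
  shows "integrable M (truncation f \<epsilon>)"
proof (rule Bochner_Integration.integrable_bound)
  show "integrable M (\<lambda>x. (1 + 1 / \<epsilon>) * Phi \<bar>f x\<bar>)"
    using assms by (auto simp: LPhi_iff)
  show "truncation f \<epsilon> \<in> borel_measurable M"
    using assms by measurable
  have "\<bar>truncation f \<epsilon> x\<bar> \<le> (1 + 1 / \<epsilon>) * Phi \<bar>f x\<bar>" for x
    using le_Phi[OF assms(2), of "\<bar>f x\<bar>"] assms(2) by (simp add: truncation_def Phi_nonneg)
  then show "AE x in M. norm (truncation f \<epsilon> x) \<le> norm ((1 + 1 / \<epsilon>) * Phi \<bar>f x\<bar>)"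
    using assms by (auto simp: Phi_nonneg abs_mult)
qed

lemma square_integrable_tail:
  assumes "f \<in> LPhi M" "0 < \<epsilon>"
  shows "integrable M (\<lambda>x. (tail f \<epsilon> x)\<^sup>2)"
proof (rule Bochner_Integration.integrable_bound)
  show "integrable M (\<lambda>x. (1 + \<epsilon>\<^sup>2) * Phi \<bar>f x\<bar>)"
    using assms by (auto simp: LPhi_iff)
  show "(\<lambda>x. (tail f \<epsilon> x)\<^sup>2) \<in> borel_measurable M"
    using assms by measurable
  have "(tail f \<epsilon> x)\<^sup>2 \<le> (1 + \<epsilon>\<^sup>2) * Phi \<bar>f x\<bar>" for x
    using min_le_Phi[OF _ assms(2), of "\<bar>f x\<bar>"]
    by (cases "\<bar>f x\<bar> \<le> \<epsilon>") (simp_all add: tail_def Phi_nonneg min_def)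
  then show "AE x in M. norm ((tail f \<epsilon> x)\<^sup>2) \<le> norm ((1 + \<epsilon>\<^sup>2) * Phi \<bar>f x\<bar>)"
    by (auto simp: Phi_nonneg abs_mult)
qed

section \<open>Domination in L2 and vanishing of the tails\<close>

lemma L2_norm_nonneg: "0 \<le> L2_norm M f"
  by (simp add: L2_norm_def)

lemma L2_norm_square: "(L2_norm M f)\<^sup>2 = (LINT x|M. (f x)\<^sup>2)"
  by (simp add: L2_norm_def)

lemma square_integrable_bound:
  fixes f g :: "'a \<Rightarrow> real"
  assumes [measurable]: "f \<in> borel_measurable M" and g: "integrable M (\<lambda>x. (g x)\<^sup>2)"
    and le: "\<And>x. \<bar>f x\<bar> \<le> \<bar>g x\<bar>"
  shows "integrable M (\<lambda>x. (f x)\<^sup>2)" and "L2_norm M f \<le> L2_norm M g"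
proof -
  have sq: "(f x)\<^sup>2 \<le> (g x)\<^sup>2" for x
    using le by (simp add: abs_le_square_iff)
  then show f: "integrable M (\<lambda>x. (f x)\<^sup>2)"
    by (intro Bochner_Integration.integrable_bound[OF g]) auto
  show "L2_norm M f \<le> L2_norm M g"
    unfolding L2_norm_def by (intro real_sqrt_le_mono integral_mono f g sq)
qed

lemma L2_norm_cmult: "L2_norm M (\<lambda>x. c * f x) = \<bar>c\<bar> * L2_norm M f"
  by (simp add: L2_norm_def power_mult_distrib real_sqrt_mult)

text \<open>A crude Minkowski inequality: the square of a sum of three terms is at most 3 times the
  sum of squares, and 3 is below the square of 2. The norm bound is applied where all three norms
  tend to 0, so a sharp constant is of no interest.\<close>

lemma square_integrable_bound3:
  fixes a b c h :: "'a \<Rightarrow> real"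
  assumes [measurable]: "h \<in> borel_measurable M"
    and i: "integrable M (\<lambda>x. (a x)\<^sup>2)" "integrable M (\<lambda>x. (b x)\<^sup>2)" "integrable M (\<lambda>x. (c x)\<^sup>2)"
    and le: "\<And>x. \<bar>h x\<bar> \<le> \<bar>a x\<bar> + \<bar>b x\<bar> + \<bar>c x\<bar>"
  shows "integrable M (\<lambda>x. (h x)\<^sup>2)"
    and "L2_norm M h \<le> 2 * (L2_norm M a + L2_norm M b + L2_norm M c)"
proof -
  have sq: "(h x)\<^sup>2 \<le> 3 * ((a x)\<^sup>2 + (b x)\<^sup>2 + (c x)\<^sup>2)" for x
  proof -
    have "(h x)\<^sup>2 \<le> (\<bar>a x\<bar> + \<bar>b x\<bar> + \<bar>c x\<bar>)\<^sup>2"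
      using le[of x] power_mono[OF le[of x] abs_ge_zero, of 2] by simp
    also have "\<dots> \<le> 3 * ((a x)\<^sup>2 + (b x)\<^sup>2 + (c x)\<^sup>2)"
    proof -
      have "(p + q + r)\<^sup>2 \<le> 3 * (p\<^sup>2 + q\<^sup>2 + r\<^sup>2)" for p q r :: real
        using zero_le_power2[of "p - q"] zero_le_power2[of "q - r"] zero_le_power2[of "p - r"]
        by (simp add: power2_eq_square algebra_simps)
      from this[of "\<bar>a x\<bar>" "\<bar>b x\<bar>" "\<bar>c x\<bar>"] show ?thesis
        by simp
    qed
    finally show ?thesis .
  qed
  have s: "integrable M (\<lambda>x. 3 * ((a x)\<^sup>2 + (b x)\<^sup>2 + (c x)\<^sup>2))"
    using i by auto
  show h: "integrable M (\<lambda>x. (h x)\<^sup>2)"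
    by (rule Bochner_Integration.integrable_bound[OF s]) (use sq in auto)
  let ?A = "L2_norm M a" and ?B = "L2_norm M b" and ?C = "L2_norm M c"
  have "(L2_norm M h)\<^sup>2 \<le> (LINT x|M. 3 * ((a x)\<^sup>2 + (b x)\<^sup>2 + (c x)\<^sup>2))"
    unfolding L2_norm_square by (intro integral_mono h s sq)
  also have "\<dots> = 3 * (?A\<^sup>2 + ?B\<^sup>2 + ?C\<^sup>2)"
    using i by (simp add: L2_norm_square)
  also have "\<dots> \<le> (2 * (?A + ?B + ?C))\<^sup>2"
  proof -
    have "0 \<le> ?A * ?B" "0 \<le> ?A * ?C" "0 \<le> ?B * ?C"
      by (simp_all add: L2_norm_nonneg)
    then show ?thesis
      by (simp add: power2_eq_square algebra_simps add_increasing)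
  qed
  finally show "L2_norm M h \<le> 2 * (?A + ?B + ?C)"
    by (rule power2_le_imp_le) (simp add: L2_norm_nonneg)
qed

lemma LPhi_add_closed:
  assumes "f \<in> LPhi M" "g \<in> LPhi M"
  shows "(\<lambda>x. f x + g x) \<in> LPhi M"
proof -
  have [measurable]: "f \<in> borel_measurable M" "g \<in> borel_measurable M"
    using assms by (auto simp: LPhi_iff)
  have "integrable M (\<lambda>x. (tail f 1 x + tail g 1 x)\<^sup>2)"
    by (rule square_integrable_bound3(1)[where a = "tail f 1" and b = "tail g 1" and c = "\<lambda>_. 0"])
      (use assms square_integrable_tail[of _ M 1] in auto)
  then have "(\<lambda>x. (truncation f 1 x + truncation g 1 x) + (tail f 1 x + tail g 1 x)) \<in> LPhi M"
    using assms by (intro LPhi_add) (auto intro!: integrable_truncation)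
  then show ?thesis
    by (simp add: tail_eq)
qed

lemma LPhi_cmult_closed:
  assumes "f \<in> LPhi M"
  shows "(\<lambda>x. c * f x) \<in> LPhi M"
proof -
  have "(\<lambda>x. c * truncation f 1 x + c * tail f 1 x) \<in> LPhi M"
    using assms square_integrable_tail[OF assms, of 1]
    by (intro LPhi_add) (auto simp: power_mult_distrib LPhi_iff[of f] intro!: integrable_truncation)
  then show ?thesis
    by (simp add: tail_eq algebra_simps)
qed

text \<open>Dominated convergence: for heights below 1 the tail at height 1 dominates, and at each
  point with nonzero value the tail vanishes as soon as the height drops below that value in
  modulus.\<close>

lemma L2_norm_tail_tendsto:
  assumes f: "f \<in> LPhi M"
  shows "((\<lambda>\<epsilon>. L2_norm M (tail f \<epsilon>)) \<longlongrightarrow> 0) (at_right 0)"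
proof (rule tendsto_at_right_sequentially[of 0 1])
  fix S :: "nat \<Rightarrow> real" assume S: "\<And>n. 0 < S n" "\<And>n. S n < 1" "S \<longlonglongrightarrow> 0"
  have [measurable]: "f \<in> borel_measurable M"
    using f by (rule LPhi_measurable)
  have "(\<lambda>n. sqrt (LINT x|M. (tail f (S n) x)\<^sup>2)) \<longlonglongrightarrow> sqrt (LINT x|M. 0)"
  proof (intro tendsto_real_sqrt integral_dominated_convergence[where w = "\<lambda>x. (tail f 1 x)\<^sup>2"])
    show "integrable M (\<lambda>x. (tail f 1 x)\<^sup>2)"
      using f by (rule square_integrable_tail) simp
    show "AE x in M. norm ((tail f (S n) x)\<^sup>2) \<le> (tail f 1 x)\<^sup>2" for n
      using S(2)[of n] by (auto simp: tail_def)
    show "AE x in M. (\<lambda>n. (tail f (S n) x)\<^sup>2) \<longlonglongrightarrow> 0"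
    proof (rule AE_I2)
      fix x
      show "(\<lambda>n. (tail f (S n) x)\<^sup>2) \<longlonglongrightarrow> 0"
      proof (cases "f x = 0")
        case False
        then have "eventually (\<lambda>n. S n < \<bar>f x\<bar>) sequentially"
          using order_tendstoD(2)[OF S(3)] by simp
        then have "eventually (\<lambda>n. (tail f (S n) x)\<^sup>2 = 0) sequentially"
          by (rule eventually_mono) (simp add: tail_def)
        then show ?thesis
          by (rule tendsto_eventually)
      qed (simp add: tail_def cong: if_cong)
    qed
  qed measurable
  then show "(\<lambda>n. L2_norm M (tail f (S n))) \<longlonglongrightarrow> 0"
    by (simp add: L2_norm_def)
qed simp

section \<open>Convergence in measure and limits at height 0\<close>

lemma tendsto_in_measure_unique:
  fixes Y Z :: "'b \<Rightarrow> real"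
  assumes F: "F \<noteq> bot" and Y: "tendsto_in_measure P X Y F" and Z: "tendsto_in_measure P X Z F"
  shows "AE \<omega> in P. Y \<omega> = Z \<omega>"
proof -
  have [measurable]: "Y \<in> borel_measurable P" "Z \<in> borel_measurable P" "\<And>t. X t \<in> borel_measurable P"
    using Y Z by (auto simp: tendsto_in_measure_def)
  \<comment> \<open>If \<open>Y\<close> and \<open>Z\<close> differ by more than twice a number,
    then \<open>X t\<close> differs from one of them by more than that number, for every
    \<open>t\<close>.\<close>
  have "AE \<omega> in P. \<bar>Y \<omega> - Z \<omega>\<bar> \<le> 2 * inverse (real (Suc n))" for n
  proof -
    let ?\<delta> = "inverse (real (Suc n))"
    let ?D = "{\<omega> \<in> space P. \<bar>Y \<omega> - Z \<omega>\<bar> > 2 * ?\<delta>}"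
    let ?e = "\<lambda>t V. emeasure P {\<omega> \<in> space P. \<bar>X t \<omega> - V \<omega>\<bar> > ?\<delta>}"
    have "((\<lambda>t. ?e t Y + ?e t Z) \<longlongrightarrow> 0 + 0) F"
      using Y Z by (intro tendsto_add) (auto simp: tendsto_in_measure_def)
    moreover have "emeasure P ?D \<le> ?e t Y + ?e t Z" for t
    proof -
      have "emeasure P ?D \<le> emeasure P ({\<omega> \<in> space P. \<bar>X t \<omega> - Y \<omega>\<bar> > ?\<delta>}
          \<union> {\<omega> \<in> space P. \<bar>X t \<omega> - Z \<omega>\<bar> > ?\<delta>})"
        by (intro emeasure_mono) (auto simp del: of_nat_Suc)
      also have "\<dots> \<le> ?e t Y + ?e t Z"
        by (intro emeasure_subadditive) measurable
      finally show ?thesis .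
    qed
    ultimately have "emeasure P ?D \<le> 0 + 0"
      using F by (intro tendsto_lowerbound[where F = F]) auto
    then show ?thesis
      by (intro AE_I[where N = ?D]) (auto simp: not_le)
  qed
  then have "AE \<omega> in P. \<forall>n. \<bar>Y \<omega> - Z \<omega>\<bar> \<le> 2 * inverse (real (Suc n))"
    by (simp only: AE_all_countable) simp
  then show ?thesis
  proof eventually_elim
    case (elim \<omega>)
    have "(\<lambda>n. 2 * inverse (real (Suc n))) \<longlonglongrightarrow> 2 * 0"
      by (intro tendsto_mult tendsto_const LIMSEQ_inverse_real_of_nat)
    from LIMSEQ_le_const[OF this, of "\<bar>Y \<omega> - Z \<omega>\<bar>"] elim show ?case
      by simp
  qed
qed

text \<open>Markov's inequality.\<close>

lemma tendsto_in_measureI_L1: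
  fixes Z :: "'b \<Rightarrow> real"
  assumes [measurable]: "\<And>t. X t \<in> borel_measurable P" "Z \<in> borel_measurable P"
    and lim: "((\<lambda>t. L1_norm P (\<lambda>\<omega>. X t \<omega> - Z \<omega>)) \<longlongrightarrow> 0) F"
  shows "tendsto_in_measure P X Z F"
  unfolding tendsto_in_measure_def
proof (intro conjI allI impI)
  fix \<delta> :: real assume \<delta>: "0 < \<delta>"
  let ?e = "\<lambda>t. emeasure P {\<omega> \<in> space P. \<bar>X t \<omega> - Z \<omega>\<bar> > \<delta>}"
  let ?b = "\<lambda>t. ennreal (1 / \<delta>) * L1_norm P (\<lambda>\<omega>. X t \<omega> - Z \<omega>)"
  have "?e t \<le> ?b t" for t
  proof -
    have "?e t = (\<integral>\<^sup>+\<omega>. indicator {\<omega> \<in> space P. \<bar>X t \<omega> - Z \<omega>\<bar> > \<delta>} \<omega> \<partial>P)"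
      by (subst nn_integral_indicator) measurable
    also have "\<dots> \<le> (\<integral>\<^sup>+\<omega>. ennreal (1 / \<delta>) * ennreal \<bar>X t \<omega> - Z \<omega>\<bar> \<partial>P)"
    proof (intro nn_integral_mono)
      fix \<omega>
      have "1 \<le> ennreal (1 / \<delta>) * ennreal \<bar>X t \<omega> - Z \<omega>\<bar>" if "\<delta> < \<bar>X t \<omega> - Z \<omega>\<bar>"
        using that \<delta> by (subst ennreal_mult[symmetric]) simp_all
      then show "indicator {\<omega> \<in> space P. \<bar>X t \<omega> - Z \<omega>\<bar> > \<delta>} \<omega>
          \<le> ennreal (1 / \<delta>) * ennreal \<bar>X t \<omega> - Z \<omega>\<bar>"
        by (simp split: split_indicator)
    qed
    also have "\<dots> = ?b t"
      unfolding L1_norm_def by (rule nn_integral_cmult) measurable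
    finally show ?thesis .
  qed
  then have le: "eventually (\<lambda>t. ?e t \<le> ?b t) F"
    by (simp only: eventually_True)
  have "(?b \<longlongrightarrow> ennreal (1 / \<delta>) * 0) F"
    by (intro ennreal_tendsto_cmult lim) simp
  then have "(?b \<longlongrightarrow> 0) F"
    by (simp only: mult_zero_right)
  from tendsto_sandwich[OF _ le tendsto_const this] show "(?e \<longlongrightarrow> 0) F"
    by (simp only: zero_le eventually_True)
qed auto

lemma ennreal_le_at_right_0:
  fixes u :: "real \<Rightarrow> real" and q a :: ennreal
  assumes u: "(u \<longlongrightarrow> 0) (at_right 0)"
    and le: "\<forall>\<^sub>F \<epsilon> in at_right 0. q \<le> a + ennreal (u \<epsilon>)"
  shows "q \<le> a"
proof -
  have "((\<lambda>\<epsilon>. a + ennreal (u \<epsilon>)) \<longlongrightarrow> a + ennreal 0) (at_right 0)"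
    by (intro tendsto_intros tendsto_ennrealI u)
  from tendsto_lowerbound[OF this le] show ?thesis
    by simp
qed

lemma eventually_at_right_0I:
  fixes b :: real
  assumes "0 < b" "\<And>\<epsilon>. 0 < \<epsilon> \<Longrightarrow> \<epsilon> < b \<Longrightarrow> Q \<epsilon>"
  shows "eventually Q (at_right 0)"
  using assms by (auto simp: eventually_at_right_field)

subsection \<open>The stochastic integral I1\<close>

context poisson_space
begin

text \<open>The two truncations differ by the part of \<open>f\<close> with modulus between the
  heights, which the tail at the larger height dominates. The bound does not involve the smaller
  height, so the compensated truncations are Cauchy in L1.\<close>

lemma L1_norm_J_truncation_diff:
  assumes f: "f \<in> LPhi M" and \<epsilon>: "0 < \<delta>" "\<delta> \<le> \<epsilon>"
  shows "L1_norm P (\<lambda>\<omega>. J (truncation f \<delta>) \<omega> - J (truncation f \<epsilon>) \<omega>)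
    \<le> ennreal (L2_norm M (tail f \<epsilon>))"
proof -
  have [measurable]: "f \<in> borel_measurable M"
    using f by (rule LPhi_measurable)
  let ?h = "\<lambda>x. truncation f \<delta> x - truncation f \<epsilon> x"
  have i: "integrable M (truncation f \<delta>)" "integrable M (truncation f \<epsilon>)"
    using \<epsilon> by (auto intro!: integrable_truncation f)
  have "\<bar>?h x\<bar> \<le> \<bar>tail f \<epsilon> x\<bar>" for x
    using \<epsilon> by (simp add: truncation_def tail_def)
  note h = square_integrable_bound[OF _ square_integrable_tail[OF f] this]
  have "L1_norm P (\<lambda>\<omega>. J (truncation f \<delta>) \<omega> - J (truncation f \<epsilon>) \<omega>) = L1_norm P (J ?h)"
    by (intro L1_norm_cong_AE, use J_diff[OF i] in eventually_elim) simp
  also have "\<dots> \<le> ennreal (L2_norm M ?h)"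
    using i h(1) \<epsilon> by (intro L1_norm_J_L2) auto
  also have "\<dots> \<le> ennreal (L2_norm M (tail f \<epsilon>))"
    using h(2) \<epsilon> by (intro ennreal_leI) auto
  finally show ?thesis .
qed

text \<open>A subsequence along heights tending to 0 converges almost surely. Fatou's lemma then
  carries the Cauchy estimate to its limit \<open>Z\<close>, at every height and not merely along
  the subsequence.\<close>

lemma compensated_truncations_converge:
  assumes f: "f \<in> LPhi M"
  obtains Z where "Z \<in> borel_measurable P"
    "\<And>\<epsilon>. 0 < \<epsilon> \<Longrightarrow> L1_norm P (\<lambda>\<omega>. J (truncation f \<epsilon>) \<omega> - Z \<omega>) \<le> ennreal (L2_norm M (tail f \<epsilon>))"
proof -
  have [measurable]: "f \<in> borel_measurable M"
    using f by (rule LPhi_measurable)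
  define e where "e n = inverse (real (Suc n))" for n
  define s where "s n = J (truncation f (e n))" for n
  have e: "0 < e n" "i \<le> j \<Longrightarrow> e j \<le> e i" for n i j
    by (auto simp: e_def)
  have e0: "e \<longlonglongrightarrow> 0"
    unfolding e_def by (rule LIMSEQ_inverse_real_of_nat)
  then have e_at: "filterlim e (at_right 0) sequentially"
    using e(1) by (intro tendsto_imp_filterlim_at_right) simp_all
  have si: "integrable P (s n)" for n
    unfolding s_def using e by (intro integrable_J integrable_truncation f) auto
  have [measurable]: "s n \<in> borel_measurable P" for n
    using si by auto
  have diff: "L1_norm P (\<lambda>\<omega>. s i \<omega> - s j \<omega>) \<le> ennreal (L2_norm M (tail f (e j)))" if "j \<le> i" for i j
    unfolding s_def using e that by (intro L1_norm_J_truncation_diff f) auto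
  obtain r where r: "strict_mono r" "AE \<omega> in P. Cauchy (\<lambda>i. s (r i) \<omega>)"
  proof (rule cauchy_L1_AE_cauchy_subseq[OF si])
    fix d :: real assume "0 < d"
    have "(\<lambda>n. L2_norm M (tail f (e n))) \<longlonglongrightarrow> 0"
      by (rule filterlim_compose[OF L2_norm_tail_tendsto[OF f] e_at])
    then have "eventually (\<lambda>n. L2_norm M (tail f (e n)) < d) sequentially"
      using \<open>0 < d\<close> by (rule order_tendstoD(2))
    then obtain N where N: "\<And>n. N \<le> n \<Longrightarrow> L2_norm M (tail f (e n)) < d"
      by (auto simp: eventually_sequentially)
    have less: "(LINT \<omega>|P. norm (s i \<omega> - s j \<omega>)) < d" if "N \<le> j" "j \<le> i" for i j
    proof -
      have "ennreal (LINT \<omega>|P. norm (s i \<omega> - s j \<omega>)) \<le> ennreal (L2_norm M (tail f (e j)))"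
        using diff[OF that(2)] si by (simp add: L1_norm_eq_integral)
      then show ?thesis
        using N[OF that(1)] by (simp add: ennreal_le_iff L2_norm_nonneg)
    qed
    \<comment> \<open>The estimate is one-sided in the order of the indices; symmetry removes
      this.\<close>
    have "(LINT \<omega>|P. norm (s i \<omega> - s j \<omega>)) < d" if "N \<le> i" "N \<le> j" for i j
      using less[of j i] less[of i j] that
      by (cases "j \<le> i") (auto simp: abs_minus_commute)
    then show "\<exists>N. \<forall>i\<ge>N. \<forall>j\<ge>N. (LINT \<omega>|P. norm (s i \<omega> - s j \<omega>)) < d"
      by (intro exI[of _ N]) simp
  qed
  define Z where "Z \<omega> = lim (\<lambda>i. s (r i) \<omega>)" for \<omega>
  have Z[measurable]: "Z \<in> borel_measurable P"
    by (subst Z_def [abs_def]) measurable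
  have lim: "AE \<omega> in P. (\<lambda>i. s (r i) \<omega>) \<longlonglongrightarrow> Z \<omega>"
    using r(2) by eventually_elim (simp add: Z_def Cauchy_convergent_iff convergent_LIMSEQ_iff)
  have "L1_norm P (\<lambda>\<omega>. J (truncation f \<epsilon>) \<omega> - Z \<omega>) \<le> ennreal (L2_norm M (tail f \<epsilon>))"
    if \<epsilon>: "0 < \<epsilon>" for \<epsilon>
  proof -
    let ?g = "\<lambda>i \<omega>. ennreal \<bar>J (truncation f \<epsilon>) \<omega> - s (r i) \<omega>\<bar>"
    have "L1_norm P (\<lambda>\<omega>. J (truncation f \<epsilon>) \<omega> - Z \<omega>) = (\<integral>\<^sup>+\<omega>. liminf (\<lambda>i. ?g i \<omega>) \<partial>P)"
      unfolding L1_norm_def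
    proof (rule nn_integral_cong_AE)
      show "AE \<omega> in P. ennreal \<bar>J (truncation f \<epsilon>) \<omega> - Z \<omega>\<bar> = liminf (\<lambda>i. ?g i \<omega>)"
        using lim
      proof eventually_elim
        case (elim \<omega>)
        then have "(\<lambda>i. ?g i \<omega>) \<longlonglongrightarrow> ennreal \<bar>J (truncation f \<epsilon>) \<omega> - Z \<omega>\<bar>"
          by (intro tendsto_ennrealI tendsto_rabs tendsto_diff tendsto_const)
        then show ?case
          by (intro lim_imp_Liminf[symmetric]) auto
      qed
    qed
    also have "\<dots> \<le> liminf (\<lambda>i. \<integral>\<^sup>+\<omega>. ?g i \<omega> \<partial>P)"
      by (rule nn_integral_liminf) measurable
    also have "\<dots> \<le> ennreal (L2_norm M (tail f \<epsilon>))"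
    proof (rule Liminf_le)
      have "eventually (\<lambda>i. e (r i) < \<epsilon>) sequentially"
        using order_tendstoD(2)[OF LIMSEQ_subseq_LIMSEQ[OF e0 r(1)] \<epsilon>] by (simp add: comp_def)
      then show "eventually (\<lambda>i. (\<integral>\<^sup>+\<omega>. ?g i \<omega> \<partial>P) \<le> ennreal (L2_norm M (tail f \<epsilon>))) sequentially"
      proof (rule eventually_mono)
        fix i assume "e (r i) < \<epsilon>"
        then show "(\<integral>\<^sup>+\<omega>. ?g i \<omega> \<partial>P) \<le> ennreal (L2_norm M (tail f \<epsilon>))"
          using L1_norm_J_truncation_diff[OF f e(1)[of "r i"], of \<epsilon>]
          by (simp add: s_def L1_norm_def abs_minus_commute)
      qed
    qed simp
    finally show ?thesis .
  qed
  with Z show ?thesis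
    by (rule that)
qed

text \<open>\<open>I1\<close> is picked by a choice operator. The limit \<open>Z\<close> shows that
  there is something to pick, and uniqueness of limits in measure transfers its L1 estimate to
  whichever version is picked.\<close>

lemma
  assumes f: "f \<in> LPhi M"
  shows measurable_I1: "I1 M P f \<in> borel_measurable P"
    and L1_norm_J_I1: "\<And>\<epsilon>. 0 < \<epsilon> \<Longrightarrow>
      L1_norm P (\<lambda>\<omega>. J (truncation f \<epsilon>) \<omega> - I1 M P f \<omega>) \<le> ennreal (L2_norm M (tail f \<epsilon>))"
proof -
  have [measurable]: "f \<in> borel_measurable M"
    using f by (rule LPhi_measurable)
  obtain Z where Z[measurable]: "Z \<in> borel_measurable P" and bound: "\<And>\<epsilon>. 0 < \<epsilon> \<Longrightarrow>
      L1_norm P (\<lambda>\<omega>. J (truncation f \<epsilon>) \<omega> - Z \<omega>) \<le> ennreal (L2_norm M (tail f \<epsilon>))"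
    using compensated_truncations_converge[OF f] by blast
  have "((\<lambda>\<epsilon>. L1_norm P (\<lambda>\<omega>. J (truncation f \<epsilon>) \<omega> - Z \<omega>)) \<longlongrightarrow> 0) (at_right 0)"
  proof (rule tendsto_sandwich[OF _ _ tendsto_const])
    show "((\<lambda>\<epsilon>. ennreal (L2_norm M (tail f \<epsilon>))) \<longlongrightarrow> 0) (at_right 0)"
      using tendsto_ennrealI[OF L2_norm_tail_tendsto[OF f]] by simp
    show "\<forall>\<^sub>F \<epsilon> in at_right 0. L1_norm P (\<lambda>\<omega>. J (truncation f \<epsilon>) \<omega> - Z \<omega>)
        \<le> ennreal (L2_norm M (tail f \<epsilon>))"
      by (rule eventually_at_right_0I[of 1]) (use bound in auto)
  qed simp
  then have tZ: "tendsto_in_measure P (\<lambda>\<epsilon>. J (truncation f \<epsilon>)) Z (at_right 0)"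
    by (intro tendsto_in_measureI_L1) auto
  have I1_eq: "I1 M P f = (SOME Z. tendsto_in_measure P (\<lambda>\<epsilon>. J (truncation f \<epsilon>)) Z (at_right 0))"
    by (simp add: I1_def J_def [abs_def])
  have tI: "tendsto_in_measure P (\<lambda>\<epsilon>. J (truncation f \<epsilon>)) (I1 M P f) (at_right 0)"
    unfolding I1_eq
    by (rule someI[of "\<lambda>Z. tendsto_in_measure P (\<lambda>\<epsilon>. J (truncation f \<epsilon>)) Z (at_right 0)", OF tZ])
  then show "I1 M P f \<in> borel_measurable P"
    by (simp add: tendsto_in_measure_def)
  have eq: "AE \<omega> in P. I1 M P f \<omega> = Z \<omega>"
    by (rule tendsto_in_measure_unique[OF _ tI tZ]) simp
  show "L1_norm P (\<lambda>\<omega>. J (truncation f \<epsilon>) \<omega> - I1 M P f \<omega>) \<le> ennreal (L2_norm M (tail f \<epsilon>))"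
    if "0 < \<epsilon>" for \<epsilon>
  proof -
    have "L1_norm P (\<lambda>\<omega>. J (truncation f \<epsilon>) \<omega> - I1 M P f \<omega>)
        = L1_norm P (\<lambda>\<omega>. J (truncation f \<epsilon>) \<omega> - Z \<omega>)"
      by (rule L1_norm_cong_AE) (use eq in eventually_elim, simp)
    with bound[OF that] show ?thesis
      by simp
  qed
qed

text \<open>The criterion by which \<open>I1\<close> is identified below: any variable that the
  compensated truncations approach in L1, at an explicit vanishing rate \<open>u\<close>, is a
  version of it.\<close>

lemma I1_eqI:
  assumes f: "f \<in> LPhi M" and Z[measurable]: "Z \<in> borel_measurable P"
    and u: "(u \<longlongrightarrow> 0) (at_right 0)"
    and le: "\<And>\<epsilon>. 0 < \<epsilon> \<Longrightarrow> L1_norm P (\<lambda>\<omega>. J (truncation f \<epsilon>) \<omega> - Z \<omega>) \<le> ennreal (u \<epsilon>)"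
    and u0: "\<And>\<epsilon>. 0 \<le> u \<epsilon>"
  shows "AE \<omega> in P. I1 M P f \<omega> = Z \<omega>"
proof -
  have [measurable]: "f \<in> borel_measurable M" "I1 M P f \<in> borel_measurable P"
    using f measurable_I1[OF f] by (simp_all add: LPhi_iff)
  have "L1_norm P (\<lambda>\<omega>. I1 M P f \<omega> - Z \<omega>) \<le> 0"
  proof (rule ennreal_le_at_right_0)
    show "((\<lambda>\<epsilon>. L2_norm M (tail f \<epsilon>) + u \<epsilon>) \<longlongrightarrow> 0) (at_right 0)"
      using tendsto_add[OF L2_norm_tail_tendsto[OF f] u] by simp
    show "\<forall>\<^sub>F \<epsilon> in at_right 0. L1_norm P (\<lambda>\<omega>. I1 M P f \<omega> - Z \<omega>)
        \<le> 0 + ennreal (L2_norm M (tail f \<epsilon>) + u \<epsilon>)"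
    proof (rule eventually_at_right_0I[of 1])
      fix \<epsilon> :: real assume \<epsilon>: "0 < \<epsilon>"
      let ?T = "J (truncation f \<epsilon>)"
      have "L1_norm P (\<lambda>\<omega>. I1 M P f \<omega> - Z \<omega>)
          = L1_norm P (\<lambda>\<omega>. (I1 M P f \<omega> - ?T \<omega>) + (?T \<omega> - Z \<omega>))"
        by simp
      also have "\<dots> \<le> L1_norm P (\<lambda>\<omega>. I1 M P f \<omega> - ?T \<omega>) + L1_norm P (\<lambda>\<omega>. ?T \<omega> - Z \<omega>)"
        by (rule L1_norm_add_le) measurable
      also have "\<dots> \<le> ennreal (L2_norm M (tail f \<epsilon>)) + ennreal (u \<epsilon>)"
        using L1_norm_J_I1[OF f \<epsilon>] le[OF \<epsilon>]
        by (intro add_mono) (simp_all add: L1_norm_minus_commute[of P "I1 M P f"])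
      finally show "L1_norm P (\<lambda>\<omega>. I1 M P f \<omega> - Z \<omega>)
          \<le> 0 + ennreal (L2_norm M (tail f \<epsilon>) + u \<epsilon>)"
        by (simp add: u0 L2_norm_nonneg)
    qed simp
  qed
  then have "L1_norm P (\<lambda>\<omega>. I1 M P f \<omega> - Z \<omega>) = 0"
    by simp
  then show ?thesis
    by (subst (asm) L1_norm_eq_0_iff) auto
qed

lemma I1_integrable:
  assumes f: "integrable M f"
  shows "AE \<omega> in P. I1 M P f \<omega> = J f \<omega>"
proof (rule I1_eqI)
  have fP: "f \<in> LPhi M" and [measurable]: "f \<in> borel_measurable M"
    using f by (auto intro: integrable_imp_LPhi)
  then show "f \<in> LPhi M" "J f \<in> borel_measurable P"
    by simp_all
  show "((\<lambda>\<epsilon>. L2_norm M (tail f \<epsilon>)) \<longlongrightarrow> 0) (at_right 0)"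
    by (rule L2_norm_tail_tendsto[OF fP])
  show "L1_norm P (\<lambda>\<omega>. J (truncation f \<epsilon>) \<omega> - J f \<omega>) \<le> ennreal (L2_norm M (tail f \<epsilon>))"
    if \<epsilon>: "0 < \<epsilon>" for \<epsilon>
  proof -
    have t: "integrable M (truncation f \<epsilon>)"
      by (rule integrable_truncation[OF fP \<epsilon>])
    have "L1_norm P (\<lambda>\<omega>. J (truncation f \<epsilon>) \<omega> - J f \<omega>) = L1_norm P (\<lambda>\<omega>. J f \<omega> - J (truncation f \<epsilon>) \<omega>)"
      by (rule L1_norm_minus_commute)
    also have "\<dots> = L1_norm P (J (\<lambda>x. f x - truncation f \<epsilon> x))"
      by (intro L1_norm_cong_AE, use J_diff[OF f t] in eventually_elim) simp
    also have "(\<lambda>x. f x - truncation f \<epsilon> x) = tail f \<epsilon>"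
      by (simp add: fun_eq_iff tail_eq)
    also have "L1_norm P (J (tail f \<epsilon>)) \<le> ennreal (L2_norm M (tail f \<epsilon>))"
      using f t by (intro L1_norm_J_L2 square_integrable_tail fP \<epsilon>) (simp add: tail_eq [abs_def])
    finally show ?thesis .
  qed
qed (rule L2_norm_nonneg)

text \<open>Truncation is not additive, but its defect is a combination of the tails of
  \<open>f\<close>, \<open>g\<close> and the sum. It therefore vanishes in L2, and \<open>J\<close>
  of it vanishes in L1.\<close>

lemma I1_add:
  assumes f: "f \<in> LPhi M" and g: "g \<in> LPhi M"
  shows "AE \<omega> in P. I1 M P (\<lambda>x. f x + g x) \<omega> = I1 M P f \<omega> + I1 M P g \<omega>"
proof (rule I1_eqI)
  let ?s = "\<lambda>x. f x + g x"
  show s: "?s \<in> LPhi M"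
    by (rule LPhi_add_closed[OF f g])
  have [measurable]: "f \<in> borel_measurable M" "g \<in> borel_measurable M"
    "I1 M P f \<in> borel_measurable P" "I1 M P g \<in> borel_measurable P"
    using f g measurable_I1[OF f] measurable_I1[OF g] by (simp_all add: LPhi_iff)
  show "(\<lambda>\<omega>. I1 M P f \<omega> + I1 M P g \<omega>) \<in> borel_measurable P"
    by measurable
  let ?L = "\<lambda>h \<epsilon>. L2_norm M (tail h \<epsilon>)"
  \<comment> \<open>The doubled bracket bounds \<open>J\<close> of the defect \<open>?h\<close>; the
    last two terms account for replacing compensated truncations by \<open>I1\<close>.\<close>
  let ?u = "\<lambda>\<epsilon>. 2 * (?L f \<epsilon> + ?L g \<epsilon> + ?L ?s \<epsilon>) + ?L f \<epsilon> + ?L g \<epsilon>"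
  note lims = L2_norm_tail_tendsto[OF f] L2_norm_tail_tendsto[OF g] L2_norm_tail_tendsto[OF s]
  have "(?u \<longlongrightarrow> 2 * (0 + 0 + 0) + 0 + 0) (at_right 0)"
    by (intro tendsto_add tendsto_mult tendsto_const lims)
  then show "(?u \<longlongrightarrow> 0) (at_right 0)"
    by simp
  show "0 \<le> ?u \<epsilon>" for \<epsilon>
    by (simp add: L2_norm_nonneg)
  fix \<epsilon> :: real assume \<epsilon>: "0 < \<epsilon>"
  let ?tf = "truncation f \<epsilon>" and ?tg = "truncation g \<epsilon>" and ?ts = "truncation ?s \<epsilon>"
  let ?h = "\<lambda>x. ?ts x - (?tf x + ?tg x)"
  have i: "integrable M ?tf" "integrable M ?tg" "integrable M ?ts"
    by (auto intro!: integrable_truncation f g s \<epsilon>)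
  have "\<bar>?h x\<bar> \<le> \<bar>tail f \<epsilon> x\<bar> + \<bar>tail g \<epsilon> x\<bar> + \<bar>tail ?s \<epsilon> x\<bar>" for x
    by (simp add: tail_eq)
  note h = square_integrable_bound3[OF _ square_integrable_tail[OF f \<epsilon>]
      square_integrable_tail[OF g \<epsilon>] square_integrable_tail[OF s \<epsilon>] this]
  have "L1_norm P (J ?h) \<le> ennreal (L2_norm M ?h)"
    using i h(1) by (intro L1_norm_J_L2) auto
  also have "\<dots> \<le> ennreal (2 * (?L f \<epsilon> + ?L g \<epsilon> + ?L ?s \<epsilon>))"
    using h(2) by (intro ennreal_leI) auto
  finally have Jh: "L1_norm P (J ?h) \<le> ennreal (2 * (?L f \<epsilon> + ?L g \<epsilon> + ?L ?s \<epsilon>))" .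
  have "L1_norm P (\<lambda>\<omega>. J ?ts \<omega> - (I1 M P f \<omega> + I1 M P g \<omega>))
      = L1_norm P (\<lambda>\<omega>. J ?h \<omega> + (J ?tf \<omega> - I1 M P f \<omega>) + (J ?tg \<omega> - I1 M P g \<omega>))"
    by (intro L1_norm_cong_AE, use J_diff[OF i(3) Bochner_Integration.integrable_add[OF i(1,2)]] J_add[OF i(1,2)]
        in eventually_elim) simp
  also have "\<dots> \<le> L1_norm P (\<lambda>\<omega>. J ?h \<omega> + (J ?tf \<omega> - I1 M P f \<omega>))
      + L1_norm P (\<lambda>\<omega>. J ?tg \<omega> - I1 M P g \<omega>)"
    by (rule L1_norm_add_le) measurable
  also have "\<dots> \<le> L1_norm P (J ?h) + L1_norm P (\<lambda>\<omega>. J ?tf \<omega> - I1 M P f \<omega>)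
      + L1_norm P (\<lambda>\<omega>. J ?tg \<omega> - I1 M P g \<omega>)"
    by (intro add_mono L1_norm_add_le order_refl) measurable
  also have "\<dots> \<le> ennreal (2 * (?L f \<epsilon> + ?L g \<epsilon> + ?L ?s \<epsilon>)) + ennreal (?L f \<epsilon>) + ennreal (?L g \<epsilon>)"
    by (intro add_mono Jh L1_norm_J_I1 f g \<epsilon>)
  also have "\<dots> = ennreal (?u \<epsilon>)"
    by (simp add: L2_norm_nonneg ennreal_plus[symmetric] del: ennreal_plus)
  finally show "L1_norm P (\<lambda>\<omega>. J ?ts \<omega> - (I1 M P f \<omega> + I1 M P g \<omega>)) \<le> ennreal (?u \<epsilon>)" .
qed

text \<open>Truncating the multiple at a height is the multiple of truncating \<open>f\<close> at
  the height divided by the modulus of \<open>c\<close>. The case of zero \<open>c\<close> is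
  settled at the level of norms in \<open>PO_norm_cmult\<close>.\<close>

lemma I1_cmult:
  assumes f: "f \<in> LPhi M" and c: "c \<noteq> 0"
  shows "AE \<omega> in P. I1 M P (\<lambda>x. c * f x) \<omega> = c * I1 M P f \<omega>"
proof (rule I1_eqI)
  show cf: "(\<lambda>x. c * f x) \<in> LPhi M"
    by (rule LPhi_cmult_closed[OF f])
  have [measurable]: "f \<in> borel_measurable M" "I1 M P f \<in> borel_measurable P"
    using f measurable_I1[OF f] by (simp_all add: LPhi_iff)
  show "(\<lambda>\<omega>. c * I1 M P f \<omega>) \<in> borel_measurable P"
    by measurable
  show "((\<lambda>\<epsilon>. L2_norm M (tail (\<lambda>x. c * f x) \<epsilon>)) \<longlongrightarrow> 0) (at_right 0)"
    by (rule L2_norm_tail_tendsto[OF cf])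
  fix \<epsilon> :: real assume \<epsilon>: "0 < \<epsilon>"
  have cut: "\<bar>c * f x\<bar> > \<epsilon> \<longleftrightarrow> \<bar>f x\<bar> > \<epsilon> / \<bar>c\<bar>" for x
    using c by (simp add: abs_mult field_simps)
  have "truncation (\<lambda>x. c * f x) \<epsilon> = (\<lambda>x. c * truncation f (\<epsilon> / \<bar>c\<bar>) x)"
    unfolding fun_eq_iff truncation_def cut by simp
  then have tr: "J (truncation (\<lambda>x. c * f x) \<epsilon>) \<omega> = c * J (truncation f (\<epsilon> / \<bar>c\<bar>)) \<omega>" for \<omega>
    by (simp only: J_cmult)
  have "tail (\<lambda>x. c * f x) \<epsilon> = (\<lambda>x. c * tail f (\<epsilon> / \<bar>c\<bar>) x)"
    unfolding fun_eq_iff tail_def cut by simp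
  then have tl: "L2_norm M (tail (\<lambda>x. c * f x) \<epsilon>) = \<bar>c\<bar> * L2_norm M (tail f (\<epsilon> / \<bar>c\<bar>))"
    by (simp add: L2_norm_cmult)
  have "L1_norm P (\<lambda>\<omega>. J (truncation (\<lambda>x. c * f x) \<epsilon>) \<omega> - c * I1 M P f \<omega>)
      = L1_norm P (\<lambda>\<omega>. c * (J (truncation f (\<epsilon> / \<bar>c\<bar>)) \<omega> - I1 M P f \<omega>))"
    by (simp add: tr right_diff_distrib)
  also have "\<dots> = ennreal \<bar>c\<bar> * L1_norm P (\<lambda>\<omega>. J (truncation f (\<epsilon> / \<bar>c\<bar>)) \<omega> - I1 M P f \<omega>)"
    by (rule L1_norm_cmult) measurable
  also have "\<dots> \<le> ennreal \<bar>c\<bar> * ennreal (L2_norm M (tail f (\<epsilon> / \<bar>c\<bar>)))"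
    using \<epsilon> c by (intro mult_left_mono L1_norm_J_I1 f) auto
  also have "\<dots> = ennreal (L2_norm M (tail (\<lambda>x. c * f x) \<epsilon>))"
    by (simp add: tl ennreal_mult L2_norm_nonneg)
  finally show "L1_norm P (\<lambda>\<omega>. J (truncation (\<lambda>x. c * f x) \<epsilon>) \<omega> - c * I1 M P f \<omega>)
      \<le> ennreal (L2_norm M (tail (\<lambda>x. c * f x) \<epsilon>))" .
qed (rule L2_norm_nonneg)

section \<open>The Poisson-Orlicz norm: bounds and norm axioms\<close>

abbreviation PO_norm :: "('a \<Rightarrow> real) \<Rightarrow> ennreal" where
  "PO_norm \<equiv> Poisson_Orlicz_norm M P"

lemma PO_norm_integrable: "integrable M f \<Longrightarrow> PO_norm f = L1_norm P (J f)"
  unfolding Poisson_Orlicz_norm_def by (intro L1_norm_cong_AE I1_integrable)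

lemma PO_norm_le_L1: "integrable M f \<Longrightarrow> PO_norm f \<le> 2 * L1_norm M f"
  using L1_norm_J by (simp add: PO_norm_integrable)

text \<open>The passage between \<open>I1\<close> and \<open>J\<close> at the cost of a vanishing
  tail. The first direction gives upper bounds and finiteness, the second gives
  definiteness.\<close>

lemma PO_norm_truncation:
  assumes f: "f \<in> LPhi M" and \<epsilon>: "0 < \<epsilon>"
  shows "PO_norm f \<le> L1_norm P (J (truncation f \<epsilon>)) + ennreal (L2_norm M (tail f \<epsilon>))"
    and "L1_norm P (J (truncation f \<epsilon>)) \<le> PO_norm f + ennreal (L2_norm M (tail f \<epsilon>))"
proof -
  have [measurable]: "f \<in> borel_measurable M" "I1 M P f \<in> borel_measurable P"
    using f measurable_I1[OF f] by (simp_all add: LPhi_iff)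
  note b = L1_norm_J_I1[OF f \<epsilon>]
  have "PO_norm f \<le> L1_norm P (J (truncation f \<epsilon>))
      + L1_norm P (\<lambda>\<omega>. J (truncation f \<epsilon>) \<omega> - I1 M P f \<omega>)"
    unfolding Poisson_Orlicz_norm_def by (rule L1_norm_le_diff) measurable
  also have "\<dots> \<le> L1_norm P (J (truncation f \<epsilon>)) + ennreal (L2_norm M (tail f \<epsilon>))"
    by (intro add_mono b order_refl)
  finally show "PO_norm f \<le> L1_norm P (J (truncation f \<epsilon>)) + ennreal (L2_norm M (tail f \<epsilon>))" .
  have "L1_norm P (J (truncation f \<epsilon>)) \<le> PO_norm f
      + L1_norm P (\<lambda>\<omega>. I1 M P f \<omega> - J (truncation f \<epsilon>) \<omega>)"
    unfolding Poisson_Orlicz_norm_def by (rule L1_norm_le_diff) measurable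
  also have "\<dots> \<le> PO_norm f + ennreal (L2_norm M (tail f \<epsilon>))"
    using b by (intro add_mono order_refl) (simp add: L1_norm_minus_commute[of P "I1 M P f"])
  finally show "L1_norm P (J (truncation f \<epsilon>)) \<le> PO_norm f + ennreal (L2_norm M (tail f \<epsilon>))" .
qed

text \<open>\<open>f\<close> itself may fail to be integrable, so the square bound on
  \<open>J\<close> is applied to its truncations, whose L2 norms are no larger.\<close>

lemma PO_norm_le_L2:
  assumes f[measurable]: "f \<in> borel_measurable M" and f2: "integrable M (\<lambda>x. (f x)\<^sup>2)"
  shows "PO_norm f \<le> ennreal (L2_norm M f)"
proof (rule ennreal_le_at_right_0)
  have fP: "f \<in> LPhi M"
    using assms by (rule square_integrable_imp_LPhi)
  show "((\<lambda>\<epsilon>. L2_norm M (tail f \<epsilon>)) \<longlongrightarrow> 0) (at_right 0)"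
    by (rule L2_norm_tail_tendsto[OF fP])
  show "\<forall>\<^sub>F \<epsilon> in at_right 0. PO_norm f \<le> ennreal (L2_norm M f) + ennreal (L2_norm M (tail f \<epsilon>))"
  proof (rule eventually_at_right_0I[of 1])
    fix \<epsilon> :: real assume \<epsilon>: "0 < \<epsilon>"
    note t = square_integrable_bound[OF _ f2 abs_truncation_le[of f \<epsilon>]]
    have "L1_norm P (J (truncation f \<epsilon>)) \<le> ennreal (L2_norm M (truncation f \<epsilon>))"
      using t(1) by (intro L1_norm_J_L2 integrable_truncation fP \<epsilon>) auto
    also have "\<dots> \<le> ennreal (L2_norm M f)"
      using t(2) by (intro ennreal_leI) auto
    finally show "PO_norm f \<le> ennreal (L2_norm M f) + ennreal (L2_norm M (tail f \<epsilon>))"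
      using PO_norm_truncation(1)[OF fP \<epsilon>] by (meson add_right_mono order_trans)
  qed simp
qed

lemma PO_norm_triangle:
  assumes f: "f \<in> LPhi M" and g: "g \<in> LPhi M"
  shows "PO_norm (\<lambda>x. f x + g x) \<le> PO_norm f + PO_norm g"
proof -
  have "PO_norm (\<lambda>x. f x + g x) = L1_norm P (\<lambda>\<omega>. I1 M P f \<omega> + I1 M P g \<omega>)"
    unfolding Poisson_Orlicz_norm_def by (intro L1_norm_cong_AE I1_add f g)
  also have "\<dots> \<le> PO_norm f + PO_norm g"
    unfolding Poisson_Orlicz_norm_def by (intro L1_norm_add_le measurable_I1 f g)
  finally show ?thesis .
qed

lemma PO_norm_cmult:
  assumes f: "f \<in> LPhi M"
  shows "PO_norm (\<lambda>x. c * f x) = ennreal \<bar>c\<bar> * PO_norm f"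
proof (cases "c = 0")
  case True
  then show ?thesis
    using PO_norm_le_L1[of "\<lambda>x. 0"] by (simp add: L1_norm_def)
next
  case False
  have "PO_norm (\<lambda>x. c * f x) = L1_norm P (\<lambda>\<omega>. c * I1 M P f \<omega>)"
    unfolding Poisson_Orlicz_norm_def by (intro L1_norm_cong_AE I1_cmult f False)
  also have "\<dots> = ennreal \<bar>c\<bar> * PO_norm f"
    unfolding Poisson_Orlicz_norm_def by (intro L1_norm_cmult measurable_I1 f)
  finally show ?thesis .
qed

lemma PO_norm_finite:
  assumes f: "f \<in> LPhi M"
  shows "PO_norm f < \<infinity>"
proof -
  have "L1_norm P (J (truncation f 1)) < \<infinity>"
    using integrable_J[OF integrable_truncation[OF f]] by (simp add: integrable_iff_L1_norm)
  then show ?thesis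
    using PO_norm_truncation(1)[OF f, of 1] by (auto intro: order.strict_trans1)
qed

text \<open>The set where \<open>f\<close> exceeds a positive \<open>a\<close> has finite measure.
  If the norm is 0, the void event of this set forces the integral of \<open>f\<close> over it to be
  at most 0, although \<open>f\<close> exceeds \<open>a\<close> there, so the set is null. Applied
  to \<open>f\<close> and to its negative this gives definiteness.\<close>

lemma PO_norm_zero_imp_le:
  assumes f: "f \<in> LPhi M" and zero: "PO_norm f = 0"
  shows "AE x in M. f x \<le> 0"
proof -
  have [measurable]: "f \<in> borel_measurable M"
    using f by (rule LPhi_measurable)
  have "AE x in M. f x \<le> a" if a: "0 < a" for a
  proof -
    define A where "A = {x \<in> space M. a < f x}"
    have A[measurable]: "A \<in> sets M"
      unfolding A_def by measurable
    have i: "integrable M (truncation f \<epsilon>)" if "0 < \<epsilon>" for \<epsilon>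
      using f that by (rule integrable_truncation)
    have "integrable M (\<lambda>x. a * indicator A x)"
    proof (rule Bochner_Integration.integrable_bound[OF i[OF a]])
      show "AE x in M. norm (a * indicator A x) \<le> norm (truncation f a x)"
        using a by (auto simp: A_def truncation_def split: split_indicator)
    qed measurable
    then have fin: "emeasure M A < \<infinity>"
      using a by (auto simp: integrable_indicator_iff)
    have fA: "integrable M (\<lambda>x. f x * indicator A x)"
    proof (rule Bochner_Integration.integrable_bound[OF i[OF a]])
      show "AE x in M. norm (f x * indicator A x) \<le> norm (truncation f a x)"
        using a by (auto simp: A_def truncation_def split: split_indicator)
    qed measurable
    have "ennreal (exp (- measure M A) * (LINT x|M. f x * indicator A x)) \<le> 0"
    proof (rule ennreal_le_at_right_0)
      show "((\<lambda>\<epsilon>. L2_norm M (tail f \<epsilon>)) \<longlongrightarrow> 0) (at_right 0)"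
        by (rule L2_norm_tail_tendsto[OF f])
      show "\<forall>\<^sub>F \<epsilon> in at_right 0. ennreal (exp (- measure M A) * (LINT x|M. f x * indicator A x))
          \<le> 0 + ennreal (L2_norm M (tail f \<epsilon>))"
      proof (rule eventually_at_right_0I[OF a])
        fix \<epsilon> :: real assume \<epsilon>: "0 < \<epsilon>" "\<epsilon> < a"
        let ?T = "J (truncation f \<epsilon>)" and ?w = "\<lambda>\<omega>. indicator {0} (emeasure \<omega> A) :: real"
        note JT = integrable_J[OF i[OF \<epsilon>(1)]]
        \<comment> \<open>Because the height is below \<open>a\<close>, truncation leaves
          \<open>f\<close> unchanged on \<open>A\<close>.\<close>
        have "(LINT x|M. f x * indicator A x) = (LINT x|M. truncation f \<epsilon> x * indicator A x)"
          using \<epsilon> by (intro Bochner_Integration.integral_cong)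
            (auto simp: A_def truncation_def split: split_indicator)
        then have "exp (- measure M A) * (LINT x|M. f x * indicator A x) = - (LINT \<omega>|P. ?w \<omega> * ?T \<omega>)"
          using void_mean_J[OF A fin i[OF \<epsilon>(1)]] by simp
        also have "\<dots> \<le> (LINT \<omega>|P. \<bar>?w \<omega> * ?T \<omega>\<bar>)"
          using integral_abs_bound[of P "\<lambda>\<omega>. ?w \<omega> * ?T \<omega>"] by linarith
        also have "\<dots> \<le> (LINT \<omega>|P. \<bar>?T \<omega>\<bar>)"
        proof (rule integral_mono)
          show "integrable P (\<lambda>\<omega>. \<bar>?w \<omega> * ?T \<omega>\<bar>)"
            using JT by (intro integrable_abs Bochner_Integration.integrable_bound[OF JT])
              (auto split: split_indicator)
        qed (use JT in \<open>auto split: split_indicator\<close>)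
        finally have "ennreal (exp (- measure M A) * (LINT x|M. f x * indicator A x)) \<le> L1_norm P ?T"
          using JT by (simp add: L1_norm_eq_integral ennreal_leI)
        also have "\<dots> \<le> 0 + ennreal (L2_norm M (tail f \<epsilon>))"
          using PO_norm_truncation(2)[OF f \<epsilon>(1)] zero by simp
        finally show "ennreal (exp (- measure M A) * (LINT x|M. f x * indicator A x))
          \<le> 0 + ennreal (L2_norm M (tail f \<epsilon>))" .
      qed
    qed
    then have "(LINT x|M. f x * indicator A x) \<le> 0"
      by (simp add: ennreal_eq_0_iff mult_le_0_iff)
    moreover have "(LINT x|M. a * indicator A x) \<le> (LINT x|M. f x * indicator A x)"
      using fin fA by (intro integral_mono) (auto simp: A_def split: split_indicator)
    moreover have "(LINT x|M. a * indicator A x) = a * measure M A"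
      using sets.sets_into_space[OF A] by (simp add: Int_absorb2)
    ultimately have "a * measure M A \<le> 0"
      by linarith
    then have "measure M A = 0"
      using a measure_nonneg[of M A] by (simp add: mult_le_0_iff)
    then have "emeasure M A = 0"
      using fin by (simp add: emeasure_eq_ennreal_measure less_top)
    then show ?thesis
      using A by (intro AE_I[where N = A]) (auto simp: A_def)
  qed
  then have "AE x in M. \<forall>n. f x \<le> inverse (real (Suc n))"
    by (simp add: AE_all_countable del: of_nat_Suc)
  then show ?thesis
  proof eventually_elim
    case (elim x)
    from LIMSEQ_le_const[OF LIMSEQ_inverse_real_of_nat, of "f x"] elim show ?case
      by simp
  qed
qed

lemma PO_norm_eq_0_iff:
  assumes f: "f \<in> LPhi M"
  shows "PO_norm f = 0 \<longleftrightarrow> (AE x in M. f x = 0)"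
proof
  assume zero: "PO_norm f = 0"
  have "PO_norm (\<lambda>x. - 1 * f x) = 0"
    using zero by (subst PO_norm_cmult[OF f]) simp
  from PO_norm_zero_imp_le[OF LPhi_cmult_closed[OF f] this] PO_norm_zero_imp_le[OF f zero]
  show "AE x in M. f x = 0"
    by eventually_elim simp
next
  assume zero: "AE x in M. f x = 0"
  have [measurable]: "f \<in> borel_measurable M"
    using f by (rule LPhi_measurable)
  have "L1_norm M f = 0"
    using zero by (simp add: L1_norm_eq_0_iff)
  moreover from this have "integrable M f"
    by (simp add: integrable_iff_L1_norm)
  ultimately show "PO_norm f = 0"
    using PO_norm_le_L1[of f] by simp
qed

lemma is_norm_on_PO_norm: "is_norm_on M (LPhi M) PO_norm"
  unfolding is_norm_on_def
  by (auto intro: LPhi_add_closed LPhi_cmult_closed integrable_imp_LPhi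
      simp: PO_norm_triangle PO_norm_cmult PO_norm_finite[unfolded infinity_ennreal_def] PO_norm_eq_0_iff)

end

subsection \<open>The Orlicz norm\<close>

definition admissible :: "'a measure \<Rightarrow> ('a \<Rightarrow> real) set" where
  "admissible M = {g \<in> borel_measurable M. (\<integral>\<^sup>+x. Psi \<bar>g x\<bar> \<partial>M) \<le> 1}"

lemma Orlicz_norm_eq: "Orlicz_norm M f = (SUP g\<in>admissible M. \<integral>\<^sup>+x. ennreal \<bar>f x * g x\<bar> \<partial>M)"
  by (simp add: Orlicz_norm_def admissible_def)

lemma Orlicz_norm_upper: "g \<in> admissible M \<Longrightarrow> (\<integral>\<^sup>+x. ennreal \<bar>f x * g x\<bar> \<partial>M) \<le> Orlicz_norm M f"
  unfolding Orlicz_norm_eq by (rule SUP_upper)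

lemma Orlicz_norm_least:
  "(\<And>g. g \<in> admissible M \<Longrightarrow> (\<integral>\<^sup>+x. ennreal \<bar>f x * g x\<bar> \<partial>M) \<le> c) \<Longrightarrow> Orlicz_norm M f \<le> c"
  unfolding Orlicz_norm_eq by (rule SUP_least)

lemma measurable_Psi [measurable]: "Psi \<in> borel_measurable borel"
  by (subst Psi_def [abs_def]) measurable

lemma admissible_measurable: "g \<in> admissible M \<Longrightarrow> g \<in> borel_measurable M"
  by (simp add: admissible_def)

lemma admissible_bounded:
  assumes "g \<in> admissible M"
  shows "AE x in M. \<bar>g x\<bar> \<le> 2"
proof -
  have [measurable]: "g \<in> borel_measurable M"
    using assms by (rule admissible_measurable)
  have "(\<integral>\<^sup>+x. Psi \<bar>g x\<bar> \<partial>M) \<noteq> \<infinity>"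
    using assms by (auto simp: admissible_def top_unique)
  then have "AE x in M. Psi \<bar>g x\<bar> \<noteq> \<infinity>"
    by (intro nn_integral_noteq_infinite) measurable
  then show ?thesis
    by eventually_elim (simp add: Psi_def split: if_splits)
qed

lemma admissible_square: "g \<in> admissible M \<Longrightarrow> (\<integral>\<^sup>+x. ennreal ((g x)\<^sup>2) \<partial>M) \<le> 1"
  by (rule order_trans[OF nn_integral_mono[of M _ "\<lambda>x. Psi \<bar>g x\<bar>"]])
    (auto simp: admissible_def Psi_def)

lemma admissibleI:
  assumes [measurable]: "g \<in> borel_measurable M" and "\<And>x. \<bar>g x\<bar> \<le> 2"
    and "(\<integral>\<^sup>+x. ennreal ((g x)\<^sup>2) \<partial>M) \<le> 1"
  shows "g \<in> admissible M"
  using assms by (simp add: admissible_def Psi_def)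

lemma Orlicz_norm_triangle:
  assumes [measurable]: "f \<in> borel_measurable M" "f' \<in> borel_measurable M"
  shows "Orlicz_norm M (\<lambda>x. f x + f' x) \<le> Orlicz_norm M f + Orlicz_norm M f'"
proof (rule Orlicz_norm_least)
  fix g assume g: "g \<in> admissible M"
  have [measurable]: "g \<in> borel_measurable M"
    using g by (rule admissible_measurable)
  have "(\<integral>\<^sup>+x. ennreal \<bar>(f x + f' x) * g x\<bar> \<partial>M)
      \<le> (\<integral>\<^sup>+x. ennreal \<bar>f x * g x\<bar> + ennreal \<bar>f' x * g x\<bar> \<partial>M)"
    by (intro nn_integral_mono)
      (simp add: distrib_right abs_triangle_ineq ennreal_plus[symmetric] del: ennreal_plus)
  also have "\<dots> = (\<integral>\<^sup>+x. ennreal \<bar>f x * g x\<bar> \<partial>M) + (\<integral>\<^sup>+x. ennreal \<bar>f' x * g x\<bar> \<partial>M)"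
    by (rule nn_integral_add) measurable
  also have "\<dots> \<le> Orlicz_norm M f + Orlicz_norm M f'"
    by (intro add_mono Orlicz_norm_upper g)
  finally show "(\<integral>\<^sup>+x. ennreal \<bar>(f x + f' x) * g x\<bar> \<partial>M) \<le> Orlicz_norm M f + Orlicz_norm M f'" .
qed

lemma Orlicz_norm_cmult:
  assumes [measurable]: "f \<in> borel_measurable M"
  shows "Orlicz_norm M (\<lambda>x. c * f x) = ennreal \<bar>c\<bar> * Orlicz_norm M f"
  unfolding Orlicz_norm_eq SUP_mult_left_ennreal
proof (rule SUP_cong)
  fix g assume "g \<in> admissible M"
  then have [measurable]: "g \<in> borel_measurable M"
    by (rule admissible_measurable)
  have "(\<integral>\<^sup>+x. ennreal \<bar>c * f x * g x\<bar> \<partial>M) = (\<integral>\<^sup>+x. ennreal \<bar>c\<bar> * ennreal \<bar>f x * g x\<bar> \<partial>M)"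
    by (simp add: abs_mult ennreal_mult mult.assoc)
  also have "\<dots> = ennreal \<bar>c\<bar> * (\<integral>\<^sup>+x. ennreal \<bar>f x * g x\<bar> \<partial>M)"
    by (rule nn_integral_cmult) measurable
  finally show "(\<integral>\<^sup>+x. ennreal \<bar>c * f x * g x\<bar> \<partial>M) = ennreal \<bar>c\<bar> * (\<integral>\<^sup>+x. ennreal \<bar>f x * g x\<bar> \<partial>M)" .
qed simp

text \<open>\<open>f\<close> is cut at height 1: the integrable part is paired with the bound 2 on
  \<open>g\<close>, the square integrable part with the square integral of \<open>g\<close>.\<close>

lemma Orlicz_norm_finite:
  assumes f: "f \<in> LPhi M"
  shows "Orlicz_norm M f < \<infinity>"
proof -
  have [measurable]: "f \<in> borel_measurable M"
    using f by (rule LPhi_measurable)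
  let ?a = "truncation f 1" and ?b = "tail f 1"
  let ?C = "2 * L1_norm M ?a + (\<integral>\<^sup>+x. ennreal ((?b x)\<^sup>2) \<partial>M) + 1"
  have "Orlicz_norm M f \<le> ?C"
  proof (rule Orlicz_norm_least)
    fix g assume g: "g \<in> admissible M"
    have [measurable]: "g \<in> borel_measurable M"
      using g by (rule admissible_measurable)
    have "(\<integral>\<^sup>+x. ennreal \<bar>f x * g x\<bar> \<partial>M)
        \<le> (\<integral>\<^sup>+x. 2 * ennreal \<bar>?a x\<bar> + ennreal ((?b x)\<^sup>2) + ennreal ((g x)\<^sup>2) \<partial>M)"
    proof (rule nn_integral_mono_AE)
      show "AE x in M. ennreal \<bar>f x * g x\<bar>
          \<le> 2 * ennreal \<bar>?a x\<bar> + ennreal ((?b x)\<^sup>2) + ennreal ((g x)\<^sup>2)"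
        using admissible_bounded[OF g]
      proof eventually_elim
        case (elim x)
        have "\<bar>?a x\<bar> * \<bar>g x\<bar> \<le> \<bar>?a x\<bar> * 2"
          using elim by (intro mult_left_mono) auto
        moreover have "\<bar>?b x\<bar> * \<bar>g x\<bar> \<le> (?b x)\<^sup>2 + (g x)\<^sup>2"
        proof -
          have "2 * (\<bar>?b x\<bar> * \<bar>g x\<bar>) \<le> (?b x)\<^sup>2 + (g x)\<^sup>2"
            using zero_le_power2[of "\<bar>?b x\<bar> - \<bar>g x\<bar>"] by (simp add: power2_diff)
          moreover have "0 \<le> \<bar>?b x\<bar> * \<bar>g x\<bar>"
            by simp
          ultimately show ?thesis
            by linarith
        qed
        moreover have "\<bar>f x * g x\<bar> = \<bar>?a x\<bar> * \<bar>g x\<bar> + \<bar>?b x\<bar> * \<bar>g x\<bar>"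
          by (simp add: truncation_def tail_def abs_mult)
        ultimately have "\<bar>f x * g x\<bar> \<le> 2 * \<bar>?a x\<bar> + (?b x)\<^sup>2 + (g x)\<^sup>2"
          by linarith
        then have "ennreal \<bar>f x * g x\<bar> \<le> ennreal (2 * \<bar>?a x\<bar> + (?b x)\<^sup>2 + (g x)\<^sup>2)"
          by (rule ennreal_leI)
        also have "\<dots> = 2 * ennreal \<bar>?a x\<bar> + ennreal ((?b x)\<^sup>2) + ennreal ((g x)\<^sup>2)"
          by (simp add: ennreal_mult)
        finally show ?case .
      qed
    qed
    also have "\<dots> = 2 * L1_norm M ?a + (\<integral>\<^sup>+x. ennreal ((?b x)\<^sup>2) \<partial>M) + (\<integral>\<^sup>+x. ennreal ((g x)\<^sup>2) \<partial>M)"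
      by (simp add: nn_integral_add nn_integral_cmult L1_norm_def)
    also have "\<dots> \<le> ?C"
      by (intro add_mono admissible_square g order_refl)
    finally show "(\<integral>\<^sup>+x. ennreal \<bar>f x * g x\<bar> \<partial>M) \<le> ?C" .
  qed
  moreover have "L1_norm M ?a < \<infinity>"
    using integrable_truncation[OF f, of 1] by (simp add: integrable_iff_L1_norm)
  moreover have "(\<integral>\<^sup>+x. ennreal ((?b x)\<^sup>2) \<partial>M) < \<infinity>"
    using square_integrable_tail[OF f, of 1] by (simp add: integrable_iff_bounded)
  ultimately show ?thesis
    by (auto simp: ennreal_mult_less_top intro: order.strict_trans1)
qed

lemma Orlicz_norm_AE_0:
  assumes "AE x in M. f x = 0"
  shows "Orlicz_norm M f = 0"
proof -
  have "Orlicz_norm M f \<le> 0"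
  proof (rule Orlicz_norm_least)
    fix g
    have "(\<integral>\<^sup>+x. ennreal \<bar>f x * g x\<bar> \<partial>M) = (\<integral>\<^sup>+x. 0 \<partial>M)"
      by (rule nn_integral_cong_AE) (use assms in eventually_elim, simp)
    then show "(\<integral>\<^sup>+x. ennreal \<bar>f x * g x\<bar> \<partial>M) \<le> 0"
      by simp
  qed
  then show ?thesis
    by simp
qed

text \<open>For a small set the cap of 2 on competitors is the only active constraint: twice the
  indicator attains it and stays admissible as long as its square integral, four times the measure,
  is at most 1.\<close>

lemma Orlicz_norm_indicator:
  assumes A[measurable]: "A \<in> sets M" and le: "4 * emeasure M A \<le> 1"
  shows "Orlicz_norm M (indicator A) = 2 * emeasure M A"
proof (rule antisym)
  show "Orlicz_norm M (indicator A) \<le> 2 * emeasure M A"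
  proof (rule Orlicz_norm_least)
    fix g assume g: "g \<in> admissible M"
    have "(\<integral>\<^sup>+x. ennreal \<bar>indicator A x * g x\<bar> \<partial>M) \<le> (\<integral>\<^sup>+x. 2 * indicator A x \<partial>M)"
    proof (rule nn_integral_mono_AE)
      show "AE x in M. ennreal \<bar>indicator A x * g x\<bar> \<le> 2 * indicator A x"
        using admissible_bounded[OF g]
        by eventually_elim (use ennreal_leI[of _ 2] in \<open>auto split: split_indicator\<close>)
    qed
    then show "(\<integral>\<^sup>+x. ennreal \<bar>indicator A x * g x\<bar> \<partial>M) \<le> 2 * emeasure M A"
      by (simp add: nn_integral_cmult_indicator)
  qed
  let ?g = "\<lambda>x. 2 * indicator A x :: real"
  have "(\<integral>\<^sup>+x. ennreal ((?g x)\<^sup>2) \<partial>M) = (\<integral>\<^sup>+x. 4 * indicator A x \<partial>M)"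
    by (intro nn_integral_cong) (auto split: split_indicator)
  then have "?g \<in> admissible M"
    using le by (intro admissibleI) (auto simp: nn_integral_cmult_indicator split: split_indicator)
  from Orlicz_norm_upper[OF this, of "indicator A"]
  have "(\<integral>\<^sup>+x. ennreal \<bar>indicator A x * ?g x\<bar> \<partial>M) \<le> Orlicz_norm M (indicator A)" .
  also have "(\<integral>\<^sup>+x. ennreal \<bar>indicator A x * ?g x\<bar> \<partial>M) = (\<integral>\<^sup>+x. 2 * indicator A x \<partial>M)"
    by (intro nn_integral_cong) (auto split: split_indicator)
  finally show "2 * emeasure M A \<le> Orlicz_norm M (indicator A)"
    by (simp add: nn_integral_cmult_indicator)
qed

section \<open>Existence of the clamping level\<close>

lemma integrable_min_square:
  assumes f: "f \<in> LPhi M" and t: "0 < t"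
  shows "integrable M (\<lambda>x. (min (\<bar>f x\<bar> / t) 1)\<^sup>2)"
proof (rule Bochner_Integration.integrable_bound)
  show "integrable M (\<lambda>x. (1 + 1\<^sup>2) * Phi \<bar>1 / t * f x\<bar>)"
    using LPhi_cmult_closed[OF f, of "1 / t"] by (simp add: LPhi_iff)
  have "(min (\<bar>f x\<bar> / t) 1)\<^sup>2 \<le> (1 + 1\<^sup>2) * Phi \<bar>1 / t * f x\<bar>" for x
    using min_le_Phi[of "\<bar>1 / t * f x\<bar>" 1] t by (simp add: abs_mult)
  then show "AE x in M. norm ((min (\<bar>f x\<bar> / t) 1)\<^sup>2) \<le> norm ((1 + 1\<^sup>2) * Phi \<bar>1 / t * f x\<bar>)"
    by (auto simp: Phi_nonneg abs_mult)
qed (use LPhi_measurable[OF f] in measurable)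

text \<open>Covers both continuity in the level and the limit at infinity. Levels bounded away from
  0 are required for the dominating function; the limit at level 0 is treated by Fatou's lemma
  instead.\<close>

lemma min_square_tendsto:
  assumes f: "f \<in> LPhi M" and a: "0 < a" "\<And>n. a \<le> u n"
    and lim: "\<And>x. (\<lambda>n. min (\<bar>f x\<bar> / u n) 1) \<longlonglongrightarrow> L x" and [measurable]: "L \<in> borel_measurable M"
  shows "(\<lambda>n. LINT x|M. (min (\<bar>f x\<bar> / u n) 1)\<^sup>2) \<longlonglongrightarrow> (LINT x|M. (L x)\<^sup>2)"
proof (rule integral_dominated_convergence[where w = "\<lambda>x. (min (\<bar>f x\<bar> / a) 1)\<^sup>2"])
  show "integrable M (\<lambda>x. (min (\<bar>f x\<bar> / a) 1)\<^sup>2)"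
    by (rule integrable_min_square[OF f a(1)])
  show "AE x in M. (\<lambda>n. (min (\<bar>f x\<bar> / u n) 1)\<^sup>2) \<longlonglongrightarrow> (L x)\<^sup>2"
    by (intro AE_I2 tendsto_power lim)
  show "AE x in M. norm ((min (\<bar>f x\<bar> / u n) 1)\<^sup>2) \<le> (min (\<bar>f x\<bar> / a) 1)\<^sup>2" for n
  proof (rule AE_I2)
    fix x
    have "\<bar>f x\<bar> / u n \<le> \<bar>f x\<bar> / a"
      using a(1) a(2)[of n] by (intro divide_left_mono) auto
    moreover have "0 < u n"
      using a(1) a(2)[of n] by linarith
    ultimately have "(min (\<bar>f x\<bar> / u n) 1)\<^sup>2 \<le> (min (\<bar>f x\<bar> / a) 1)\<^sup>2"
      by (intro power_mono min.mono) auto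
    then show "norm ((min (\<bar>f x\<bar> / u n) 1)\<^sup>2) \<le> (min (\<bar>f x\<bar> / a) 1)\<^sup>2"
      by simp
  qed
qed (use LPhi_measurable[OF f] in measurable)

text \<open>Intermediate value theorem for \<open>h\<close>: it tends to 0 at infinity, and near 0
  it cannot stay below 1/4, as Fatou's lemma would then bound the measure of the support by
  1/4.\<close>

lemma min_square_level:
  assumes f: "f \<in> LPhi M" and big: "\<not> emeasure M {x \<in> space M. f x \<noteq> 0} \<le> ennreal (1 / 4)"
  obtains t where "0 < t" "(LINT x|M. (min (\<bar>f x\<bar> / t) 1)\<^sup>2) = 1 / 4"
proof -
  note [measurable] = LPhi_measurable[OF f]
  define h where "h t = (LINT x|M. (min (\<bar>f x\<bar> / t) 1)\<^sup>2)" for t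
  obtain a where a: "0 < a" "1 / 4 \<le> h a"
  proof (rule ccontr)
    assume no: "\<not> thesis"
    define e where "e n = inverse (real (Suc n))" for n
    have e: "0 < e n" for n
      by (simp add: e_def)
    have e0: "e \<longlonglongrightarrow> 0"
      unfolding e_def by (rule LIMSEQ_inverse_real_of_nat)
    let ?g = "\<lambda>n x. ennreal ((min (\<bar>f x\<bar> / e n) 1)\<^sup>2)"
    have h_le: "h (e n) \<le> 1 / 4" for n
      using no that e[of n] by force
    have "emeasure M {x \<in> space M. f x \<noteq> 0} = (\<integral>\<^sup>+x. indicator {x \<in> space M. f x \<noteq> 0} x \<partial>M)"
      by (rule nn_integral_indicator[symmetric]) measurable
    also have "\<dots> = (\<integral>\<^sup>+x. liminf (\<lambda>n. ?g n x) \<partial>M)"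
    proof (rule nn_integral_cong)
      fix x assume x: "x \<in> space M"
      have "(\<lambda>n. ?g n x) \<longlonglongrightarrow> indicator {x \<in> space M. f x \<noteq> 0} x"
      proof (cases "f x = 0")
        case False
        then have "eventually (\<lambda>n. e n < \<bar>f x\<bar>) sequentially"
          using order_tendstoD(2)[OF e0] by simp
        then have "eventually (\<lambda>n. ?g n x = 1) sequentially"
        proof (rule eventually_mono)
          fix n assume "e n < \<bar>f x\<bar>"
          then have "1 \<le> \<bar>f x\<bar> / e n"
            using e[of n] by simp
          then show "?g n x = 1"
            by (simp add: min_def)
        qed
        then show ?thesis
          using False x by (auto intro: tendsto_eventually)
      qed simp
      then show "indicator {x \<in> space M. f x \<noteq> 0} x = liminf (\<lambda>n. ?g n x)"
        by (intro lim_imp_Liminf[symmetric]) auto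
    qed
    also have "\<dots> \<le> liminf (\<lambda>n. \<integral>\<^sup>+x. ?g n x \<partial>M)"
      by (rule nn_integral_liminf) measurable
    also have "\<dots> \<le> ennreal (1 / 4)"
    proof (rule Liminf_le)
      have "(\<integral>\<^sup>+x. ?g n x \<partial>M) = ennreal (h (e n))" for n
        unfolding h_def by (intro nn_integral_eq_integral integrable_min_square f e) simp
      then show "eventually (\<lambda>n. (\<integral>\<^sup>+x. ?g n x \<partial>M) \<le> ennreal (1 / 4)) sequentially"
        using h_le by (simp add: ennreal_leI del: divide_ennreal_def)
    qed simp
    finally show False
      using big by simp
  qed
  have "(\<lambda>n. h (a + real n)) \<longlonglongrightarrow> (LINT x|M. 0\<^sup>2)"
    unfolding h_def
  proof (rule min_square_tendsto[OF f a(1)])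
    fix x
    have "filterlim (\<lambda>n. a + real n) at_top sequentially"
      by (intro filterlim_tendsto_add_at_top[OF tendsto_const] filterlim_real_sequentially)
    then have "(\<lambda>n. \<bar>f x\<bar> / (a + real n)) \<longlonglongrightarrow> 0"
      by (intro tendsto_divide_0[OF tendsto_const] filterlim_at_top_imp_at_infinity)
    then have "(\<lambda>n. min (\<bar>f x\<bar> / (a + real n)) 1) \<longlonglongrightarrow> min 0 1"
      by (intro tendsto_min tendsto_const)
    then show "(\<lambda>n. min (\<bar>f x\<bar> / (a + real n)) 1) \<longlonglongrightarrow> 0"
      by simp
  qed auto
  then have "eventually (\<lambda>n. h (a + real n) < 1 / 4) sequentially"
    by (intro order_tendstoD(2)) auto
  then obtain n where n: "h (a + real n) < 1 / 4"
    by (auto simp: eventually_sequentially)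
  have "continuous_on {a..a + real n} h"
  proof (rule continuous_on_sequentiallyI)
    fix u s assume u: "\<forall>k. u k \<in> {a..a + real n}" and s: "s \<in> {a..a + real n}" "u \<longlonglongrightarrow> s"
    have "(\<lambda>k. LINT x|M. (min (\<bar>f x\<bar> / u k) 1)\<^sup>2) \<longlonglongrightarrow> (LINT x|M. (min (\<bar>f x\<bar> / s) 1)\<^sup>2)"
    proof (rule min_square_tendsto[OF f a(1)])
      show "(\<lambda>k. min (\<bar>f x\<bar> / u k) 1) \<longlonglongrightarrow> min (\<bar>f x\<bar> / s) 1" for x
        using a(1) s u by (intro tendsto_min tendsto_divide tendsto_const) auto
    qed (use u in auto)
    then show "(\<lambda>k. h (u k)) \<longlonglongrightarrow> h s"
      by (simp only: h_def)
  qed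
  then obtain t where "a \<le> t" "h t = 1 / 4"
    using IVT2'[of h "a + real n" "1 / 4" a] n a by auto
  then show thesis
    using a(1) by (intro that[of t]) (auto simp: h_def)
qed

context poisson_space
begin

text \<open>Here a clamping level may fail to exist. Instead twice the indicator of the support is
  admissible, and pairing \<open>f\<close> with it gives exactly the bound from the L1 norm.
  \<open>f\<close> is integrable since its tail is bounded on a set of finite measure.\<close>

lemma PO_norm_le_Orlicz_norm_small_support:
  assumes f: "f \<in> LPhi M" and small: "emeasure M {x \<in> space M. f x \<noteq> 0} \<le> ennreal (1 / 4)"
  shows "PO_norm f \<le> Orlicz_norm M f"
proof -
  have [measurable]: "f \<in> borel_measurable M"
    using f by (rule LPhi_measurable)
  let ?A = "{x \<in> space M. f x \<noteq> 0}"
  let ?g = "\<lambda>x. 2 * indicator ?A x :: real"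
  have "emeasure M ?A < \<infinity>"
    using small by (rule order.strict_trans1) simp
  then have "integrable M (tail f 1)"
    by (intro integrableI_bounded_set[where A = ?A and B = 1]) (auto simp: tail_def)
  with integrable_truncation[OF f, of 1] have "integrable M (\<lambda>x. truncation f 1 x + tail f 1 x)"
    by (intro Bochner_Integration.integrable_add) auto
  then have i: "integrable M f"
    by (simp add: tail_eq)
  have "(\<integral>\<^sup>+x. ennreal ((?g x)\<^sup>2) \<partial>M) = (\<integral>\<^sup>+x. 4 * indicator ?A x \<partial>M)"
    by (intro nn_integral_cong) (auto split: split_indicator)
  also have "\<dots> \<le> 4 * ennreal (1 / 4)"
    using small by (subst nn_integral_cmult_indicator) (auto intro: mult_left_mono)
  also have "\<dots> = 1"
    by (subst ennreal_numeral[symmetric], subst ennreal_mult[symmetric]) simp_all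
  finally have g: "?g \<in> admissible M"
    by (intro admissibleI) (auto split: split_indicator)
  have "PO_norm f \<le> 2 * L1_norm M f"
    by (rule PO_norm_le_L1[OF i])
  also have "\<dots> = (\<integral>\<^sup>+x. ennreal \<bar>f x * ?g x\<bar> \<partial>M)"
    unfolding L1_norm_def
    by (subst nn_integral_cmult[symmetric])
      (auto intro!: nn_integral_cong simp: abs_mult ennreal_mult mult.commute split: split_indicator)
  also have "\<dots> \<le> Orlicz_norm M f"
    by (rule Orlicz_norm_upper[OF g])
  finally show ?thesis .
qed

lemma PO_norm_le_Orlicz_norm:
  assumes f: "f \<in> LPhi M"
  shows "PO_norm f \<le> Orlicz_norm M f"
proof (cases "emeasure M {x \<in> space M. f x \<noteq> 0} \<le> ennreal (1 / 4)")
  case True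
  then show ?thesis
    by (rule PO_norm_le_Orlicz_norm_small_support[OF f])
next
  case False
  have [measurable]: "f \<in> borel_measurable M"
    using f by (rule LPhi_measurable)
  obtain t where t: "0 < t" and level: "(LINT x|M. (min (\<bar>f x\<bar> / t) 1)\<^sup>2) = 1 / 4"
    using min_square_level[OF f False] by blast
  let ?m = "\<lambda>x. min (\<bar>f x\<bar> / t) 1"
  \<comment> \<open>\<open>?b\<close> is the clamped function, estimated in L2, and
    \<open>?a\<close> the excess over the level, estimated in L1.\<close>
  let ?b = "\<lambda>x. max (- t) (min t (f x))"
  let ?a = "\<lambda>x. f x - ?b x"
  let ?g = "\<lambda>x. 2 * ?m x"
  have m2: "integrable M (\<lambda>x. (?m x)\<^sup>2)"
    by (rule integrable_min_square[OF f t])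
  have b2: "(?b x)\<^sup>2 = t\<^sup>2 * (?m x)\<^sup>2" for x
  proof -
    have "\<bar>?b x\<bar> = t * ?m x"
      using t by (auto simp: min_def max_def abs_if field_simps)
    then have "\<bar>?b x\<bar>\<^sup>2 = (t * ?m x)\<^sup>2"
      by simp
    then show ?thesis
      by (simp add: power_mult_distrib)
  qed
  have b_int: "integrable M (\<lambda>x. (?b x)\<^sup>2)"
    using m2 by (simp add: b2)
  have "(LINT x|M. (?b x)\<^sup>2) = (t / 2)\<^sup>2"
    using level by (simp add: b2 power_divide)
  then have b_norm: "L2_norm M ?b = t / 2"
    using t by (simp add: L2_norm_def)
  have "\<bar>?a x\<bar> \<le> \<bar>truncation f t x\<bar>" for x
    using t by (auto simp: truncation_def min_def max_def abs_if)
  then have a_int: "integrable M ?a"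
    by (intro Bochner_Integration.integrable_bound[OF integrable_truncation[OF f t]]) auto
  \<comment> \<open>The key identity. By the choice of \<open>t\<close> the first term integrates to
    \<open>t / 2\<close>, the L2 norm of \<open>?b\<close>, and the second to twice the L1 norm of
    \<open>?a\<close>. The two estimates thus add up to the pairing of \<open>f\<close> with the
    competitor, without loss.\<close>
  have fg: "\<bar>f x * ?g x\<bar> = 2 * t * (?m x)\<^sup>2 + 2 * \<bar>?a x\<bar>" for x
  proof (cases "\<bar>f x\<bar> \<le> t")
    case True
    then have "?m x = \<bar>f x\<bar> / t" "?a x = 0"
      using t by (auto simp: min_def max_def)
    then show ?thesis
      using t by (simp add: abs_mult power2_eq_square)
  next
    case False
    then have "f x < - t \<or> t < f x"
      by linarith
    then have "\<bar>?a x\<bar> = \<bar>f x\<bar> - t"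
      using t by (auto simp: min_def max_def)
    moreover have "?m x = 1"
      using False t by simp
    ultimately show ?thesis
      by (simp add: abs_mult)
  qed
  have "(\<integral>\<^sup>+x. ennreal ((?g x)\<^sup>2) \<partial>M) = ennreal (LINT x|M. (?g x)\<^sup>2)"
    using m2 by (intro nn_integral_eq_integral) (auto simp: power_mult_distrib)
  also have "\<dots> = 1"
    using level by (simp add: power_mult_distrib)
  finally have g: "?g \<in> admissible M"
    using t by (intro admissibleI) auto
  have "PO_norm f = PO_norm (\<lambda>x. ?b x + ?a x)"
    by simp
  also have "\<dots> \<le> PO_norm ?b + PO_norm ?a"
    by (intro PO_norm_triangle square_integrable_imp_LPhi b_int integrable_imp_LPhi a_int) measurable
  also have "\<dots> \<le> ennreal (L2_norm M ?b) + 2 * L1_norm M ?a"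
    by (intro add_mono PO_norm_le_L2 PO_norm_le_L1 b_int a_int) measurable
  also have "\<dots> = (\<integral>\<^sup>+x. ennreal (2 * t * (?m x)\<^sup>2) \<partial>M) + (\<integral>\<^sup>+x. ennreal (2 * \<bar>?a x\<bar>) \<partial>M)"
  proof (intro arg_cong2[where f = "(+)"])
    have "(\<integral>\<^sup>+x. ennreal (2 * t * (?m x)\<^sup>2) \<partial>M) = ennreal (LINT x|M. 2 * t * (?m x)\<^sup>2)"
      using m2 t by (intro nn_integral_eq_integral) auto
    then show "ennreal (L2_norm M ?b) = (\<integral>\<^sup>+x. ennreal (2 * t * (?m x)\<^sup>2) \<partial>M)"
      using level by (simp add: b_norm)
    show "2 * L1_norm M ?a = (\<integral>\<^sup>+x. ennreal (2 * \<bar>?a x\<bar>) \<partial>M)"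
      unfolding L1_norm_def by (subst nn_integral_cmult[symmetric]) (auto simp: ennreal_mult)
  qed
  also have "\<dots> = (\<integral>\<^sup>+x. ennreal (2 * t * (?m x)\<^sup>2) + ennreal (2 * \<bar>?a x\<bar>) \<partial>M)"
    by (rule nn_integral_add[symmetric]) measurable
  also have "\<dots> = (\<integral>\<^sup>+x. ennreal \<bar>f x * ?g x\<bar> \<partial>M)"
    unfolding fg using t by (intro nn_integral_cong ennreal_plus[symmetric]) auto
  also have "\<dots> \<le> Orlicz_norm M f"
    by (rule Orlicz_norm_upper[OF g])
  finally show ?thesis .
qed

text \<open>Definiteness is inherited from the Poisson-Orlicz norm, which the Orlicz norm
  dominates.\<close>

lemma is_norm_on_Orlicz_norm: "is_norm_on M (LPhi M) (Orlicz_norm M)"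
proof -
  have "Orlicz_norm M f = 0 \<longleftrightarrow> (AE x in M. f x = 0)" if f: "f \<in> LPhi M" for f
    using PO_norm_le_Orlicz_norm[OF f] PO_norm_eq_0_iff[OF f] Orlicz_norm_AE_0[of f M] by auto
  then show ?thesis
    unfolding is_norm_on_def
    using Orlicz_norm_triangle[of _ M] Orlicz_norm_cmult[of _ M]
      Orlicz_norm_finite[of _ M, unfolded infinity_ennreal_def]
    by (auto intro: LPhi_add_closed LPhi_cmult_closed integrable_imp_LPhi simp: LPhi_iff[THEN iffD1])
qed

lemma PO_norm_indicator:
  assumes A[measurable]: "A \<in> sets M" "emeasure M A < \<infinity>" and le: "measure M A \<le> 1"
  shows "PO_norm (indicator A) = ennreal (2 * measure M A * exp (- measure M A))"
proof -
  let ?l = "measure M A"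
  have i: "integrable M (indicator A :: 'a \<Rightarrow> real)"
    using A by (simp add: integrable_indicator_iff)
  have AM: "A \<subseteq> space M"
    using A(1) by (rule sets.sets_into_space)
  have const: "has_bochner_integral P (\<lambda>_. ?l) ?l"
    by (simp add: has_bochner_integral_iff P.prob_space)
  have "has_bochner_integral P (\<lambda>\<omega>. measure \<omega> A - ?l + 2 * ?l * indicator {0} (emeasure \<omega> A))
      (?l - ?l + 2 * ?l * exp (- ?l))"
    by (intro has_bochner_integral_add has_bochner_integral_diff has_bochner_integral_mult_right
        count_mean prob_void const A)
  \<comment> \<open>A count is a natural number and the mean is at most 1, so the centred count is
    negative at most when the count is 0. Correcting the sign there costs twice the mean, on an
    event of probability \<open>exp (- ?l)\<close>.\<close>
  moreover have "AE \<omega> in P. \<bar>J (indicator A) \<omega>\<bar>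
      = measure \<omega> A - ?l + 2 * ?l * indicator {0} (emeasure \<omega> A)"
    using AE_count_nat[OF A] AE_space
  proof eventually_elim
    case (elim \<omega>)
    then obtain n where n: "emeasure \<omega> A = of_nat n"
      by blast
    have J: "J (indicator A) \<omega> = measure \<omega> A - ?l"
      using elim AM by (simp add: J_def space_config Int_absorb2)
    have m: "measure \<omega> A = real n"
      by (simp add: measure_def n)
    show ?case
      using le by (cases n) (auto simp: J m n)
  qed
  ultimately have "(LINT \<omega>|P. \<bar>J (indicator A) \<omega>\<bar>) = 2 * ?l * exp (- ?l)"
    by (subst integral_cong_AE) (auto simp: has_bochner_integral_iff)
  then show ?thesis
    using integrable_J[OF i] by (simp add: PO_norm_integrable[OF i] L1_norm_eq_integral)
qed

end

section \<open>Transfer from the real line, and the conclusion\<close>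

lemma isomorphic_to_real_line_sigma_finite:
  assumes "isomorphic_to_real_line M"
  shows "sigma_finite_measure M"
proof -
  obtain T where T: "T \<in> M \<rightarrow>\<^sub>M (borel :: real measure)" and d: "distr M borel T = lborel"
    using assms unfolding isomorphic_to_real_line_def by blast
  have "sigma_finite_measure (distr M borel T)"
    unfolding d by (rule lborel.sigma_finite_measure_axioms)
  then show ?thesis
    using T by (rule sigma_finite_measure_distr)
qed

lemma isomorphic_to_real_line_set:
  assumes "isomorphic_to_real_line M" "0 \<le> l"
  obtains A where "A \<in> sets M" "emeasure M A = ennreal l"
proof -
  obtain T where T[measurable]: "T \<in> M \<rightarrow>\<^sub>M (borel :: real measure)" and d: "distr M borel T = lborel"
    using assms unfolding isomorphic_to_real_line_def by blast
  have "emeasure M (T -` {0..l} \<inter> space M) = emeasure (distr M borel T) {0..l}"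
    by (rule emeasure_distr[symmetric]) measurable
  also have "\<dots> = ennreal l"
    using assms(2) by (simp add: d)
  finally show thesis
    by (intro that[of "T -` {0..l} \<inter> space M"]) measurable
qed

theorem proposition23:
  fixes M :: "'a measure" and P :: "'a measure measure"
  assumes "isomorphic_to_real_line M"
    and "is_poisson_measure M P"
  shows "(\<forall>f. integrable M f \<longrightarrow> Poisson_Orlicz_norm M P f \<le> 2 * L1_norm M f) \<and>
    (\<forall>f \<in> borel_measurable M. integrable M (\<lambda>x. (f x)\<^sup>2) \<longrightarrow>
       Poisson_Orlicz_norm M P f \<le> ennreal (L2_norm M f)) \<and>
    (\<forall>f \<in> LPhi M. Poisson_Orlicz_norm M P f \<le> Orlicz_norm M f) \<and>
    is_norm_on M (LPhi M) (Poisson_Orlicz_norm M P) \<and>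
    is_norm_on M (LPhi M) (Orlicz_norm M) \<and>
    (\<exists>f \<in> LPhi M. Poisson_Orlicz_norm M P f \<noteq> Orlicz_norm M f) \<and>
    \<not> (\<exists>c::real. c < 1 \<and>
         (\<forall>f \<in> LPhi M. Poisson_Orlicz_norm M P f \<le> ennreal c * Orlicz_norm M f))"
proof -
  interpret sigma_finite_measure M
    by (rule isomorphic_to_real_line_sigma_finite[OF assms(1)])
  interpret prob_space P
    using assms(2) by (simp add: is_poisson_measure_def)
  interpret poisson_space M P
    by unfold_locales (rule assms(2))
  \<comment> \<open>Indicators of small sets: the quotient of the two norms is
    \<open>exp (- l)\<close>, which is below 1 but tends to 1 with \<open>l\<close> tending to 0.
    The limit 1/4 is the range of \<open>Orlicz_norm_indicator\<close>.\<close>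
  have small: "\<exists>f \<in> LPhi M. PO_norm f = ennreal (2 * l * exp (- l)) \<and> Orlicz_norm M f = ennreal (2 * l)"
    if l: "0 < l" "l \<le> 1 / 4" for l
  proof -
    obtain A where A: "A \<in> sets M" "emeasure M A = ennreal l"
      using isomorphic_to_real_line_set[OF assms(1), of l] l by auto
    have m: "measure M A = l"
      using A l by (simp add: measure_def)
    have four: "4 * ennreal l = ennreal (4 * l)" "2 * ennreal l = ennreal (2 * l)"
      using l by (simp_all add: ennreal_mult)
    have "4 * emeasure M A \<le> 1"
      unfolding A(2) four using l by simp
    then have "Orlicz_norm M (indicator A) = ennreal (2 * l)"
      using Orlicz_norm_indicator[OF A(1)] by (simp add: A(2) four)
    moreover have "PO_norm (indicator A) = ennreal (2 * l * exp (- l))"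
      using PO_norm_indicator[OF A(1)] l by (simp add: A(2) m)
    moreover have "indicator A \<in> LPhi M"
      using A by (intro integrable_imp_LPhi) (simp add: integrable_indicator_iff)
    ultimately show ?thesis
      by blast
  qed
  have different: "\<exists>f \<in> LPhi M. PO_norm f \<noteq> Orlicz_norm M f"
  proof -
    obtain f where f: "f \<in> LPhi M" "PO_norm f = ennreal (2 * (1 / 4) * exp (- (1 / 4)))"
      "Orlicz_norm M f = ennreal (2 * (1 / 4))"
      using small[of "1 / 4"] by auto
    have "PO_norm f \<noteq> Orlicz_norm M f"
      unfolding f(2,3) by (subst ennreal_inj) auto
    then show ?thesis
      using f(1) by blast
  qed
  have optimal: "\<exists>f \<in> LPhi M. \<not> PO_norm f \<le> ennreal c * Orlicz_norm M f" if c: "c < 1" for c :: real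
  proof -
    \<comment> \<open>Halving \<open>1 - c\<close> keeps \<open>1 - l\<close> strictly above
      \<open>c\<close>, and 1/4 keeps it positive; \<open>exp (- l)\<close> is larger still.\<close>
    define l where "l = min (1 / 4) ((1 - c) / 2)"
    have l: "0 < l" "l \<le> 1 / 4" "l \<le> (1 - c) / 2"
      using c unfolding l_def by (simp_all only: min.cobounded1 min.cobounded2 min_less_iff_conj) simp
    obtain f where f: "f \<in> LPhi M" "PO_norm f = ennreal (2 * l * exp (- l))"
      "Orlicz_norm M f = ennreal (2 * l)"
      using small[OF l(1,2)] by auto
    \<comment> \<open>\<open>ennreal c\<close> is 0 for negative \<open>c\<close>, so the comparison
      has to be made with \<open>max c 0\<close>.\<close>
    have "max c 0 < 1 - l"
      using l c by auto
    also have "\<dots> \<le> exp (- l)"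
      using exp_ge_add_one_self[of "- l"] by simp
    finally have "max c 0 * (2 * l) < exp (- l) * (2 * l)"
      using l(1) by (intro mult_strict_right_mono) auto
    then have "ennreal (max c 0 * (2 * l)) < ennreal (2 * l * exp (- l))"
      using l(1) by (intro ennreal_lessI) (auto simp: mult.commute)
    moreover have "ennreal (max c 0 * (2 * l)) = ennreal c * ennreal (2 * l)"
      using l(1) by (subst ennreal_mult) (auto simp: max_def ennreal_neg)
    ultimately show ?thesis
      using f by (intro bexI[of _ f]) (simp_all add: not_le)
  qed
  show ?thesis
  proof (intro conjI allI ballI impI notI)
    assume "\<exists>c::real. c < 1 \<and> (\<forall>f \<in> LPhi M. PO_norm f \<le> ennreal c * Orlicz_norm M f)"
    then show False
      using optimal by blast
  qed (use PO_norm_le_L1 PO_norm_le_L2 PO_norm_le_Orlicz_norm is_norm_on_PO_norm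
      is_norm_on_Orlicz_norm different in auto)
qed

end
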